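(* Assume the nonexpansive case $\mu_2(\sigma A)\le 0$. Let $L_m(t)v = \mathrm{e}^{\sigma t A}v - V_m\,\mathrm{e}^{\sigma t T_m}e_1$ be the error of the Krylov approximation to $\mathrm{e}^{\sigma tA}v$. The upper bound $\|L_m(t)v\|_2\le \tau_{m+1,m}\gamma_m\frac{t^m}{m!}$ is asymptotically correct for $t\to 0$, i.e. $$\| L_m(t)v \|_2 = \tau_{m+1,m}\,\gamma_m\,\frac{t^m}{m!} + \mathcal{O}(t^{m+1}).$$
   Context: Setting: $A\in\mathbb{C}^{n\times n}$, $\sigma\in\mathbb{C}$ with $|\sigma|=1$, $v\in\mathbb{C}^n$ with $\|v\|_2=1$, $t\ge 0$ real, and $m\ge 1$ an integer. Krylov decomposition: the Arnoldi iteration (Lanczos if $A$ is Hermitian) applied to $A$ and $v$ is assumed to run until dimension $m$ without breakdown (i.e. $v,Av,\dots,A^m v$ are linearly independent). It yields a matrix $V_m\in\mathbb{C}^{n\times m}$ with $V_m^*V_m=I$ whose columns span $\mathcal{K}_m(A,v)=\mathrm{span}\{v,Av,\dots,A^{m-1}v\}$ and whose first column is $v$ (so $V_me_1=v$), an upper Hessenberg matrix $T_m=V_m^*AV_m\in\mathbb{C}^{m\times m}$ with positive lower diagonal entries $(T_m)_{j+1,j}>0$, a number $\tau_{m+1,m}>0$ and a vector $v_{m+1}\in\mathbb{C}^n$ with $\|v_{m+1}\|_2=1$, $V_m^*v_{m+1}=0$, such that $$A V_m = V_mT_m + \tau_{m+1,m}\,v_{m+1}e_m^*.$$ Here $e_1=(1,0,\dots,0)^*$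 and $e_m=(0,\dots,0,1)^*$ in $\mathbb{C}^m$. Notation: $\gamma_m=e_m^*T_m^{m-1}e_1=\prod_{j=1}^{m-1}(T_m)_{j+1,j}$. Nonexpansive case: $\mu_2(\sigma A)\le 0$, where $\mu_2$ is the logarithmic norm associated with the 2-norm; equivalently the field of values $W(\sigma A)=\{x^*\sigma A x:\|x\|_2=1\}$ is contained in $\mathbb{C}_-=\{z:\mathrm{Re}\,z\le 0\}$. In this case the upper bound in the claim is valid for all $t\ge0$. *)

theory Defs
  imports
    "Jordan_Normal_Form.Schur_Decomposition"
    "HOL-Library.Landau_Symbols"
begin

definition vec_norm2 :: "complex vec \<Rightarrow> real" where
  "vec_norm2 x = sqrt (\<Sum>i<dim_vec x. (cmod (x $ i))\<^sup>2)"

definition mat_norm2 :: "complex mat \<Rightarrow> real" where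
  "mat_norm2 A = (SUP x\<in>{x \<in> carrier_vec (dim_col A). vec_norm2 x = 1}. vec_norm2 (A *\<^sub>v x))"

definition log_norm2 :: "complex mat \<Rightarrow> real" where
  "log_norm2 A =
     Lim (at_right 0)
       (\<lambda>h::real. (mat_norm2 (1\<^sub>m (dim_row A) + complex_of_real h \<cdot>\<^sub>m A) - 1) / h)"

(* Entrywise exponential series; it converges absolutely for every square matrix. *)
definition mat_exp :: "complex mat \<Rightarrow> complex mat" where
  "mat_exp A = mat (dim_row A) (dim_col A) (\<lambda>(i, j). \<Sum>k. (A ^\<^sub>m k) $$ (i, j) / fact k)"

(* The rank-one matrix x y^*. *)
definition outer_prod :: "complex vec \<Rightarrow> complex vec \<Rightarrow> complex mat" where
  "outer_prod x y = mat (dim_vec x) (dim_vec y) (\<lambda>(i, j). x $ i * cnj (y $ j))"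

definition krylov_seq :: "complex mat \<Rightarrow> complex vec \<Rightarrow> nat \<Rightarrow> complex vec list" where
  "krylov_seq A v k = map (\<lambda>i. (A ^\<^sub>m i) *\<^sub>v v) [0..<k]"

definition krylov_space :: "complex mat \<Rightarrow> complex vec \<Rightarrow> nat \<Rightarrow> complex vec set" where
  "krylov_space A v k =
     LinearCombinations.module.span class_ring (module_vec TYPE(complex) (dim_vec v))
       (set (krylov_seq A v k))"

(* v, A v, ..., A^m v are linearly independent as a family, hence the distinctness. *)
definition no_breakdown :: "complex mat \<Rightarrow> complex vec \<Rightarrow> nat \<Rightarrow> bool" where
  "no_breakdown A v m \<longleftrightarrow>
     distinct (krylov_seq A v (Suc m)) \<and>
     LinearCombinations.module.lin_indpt class_ring (module_vec TYPE(complex) (dim_vec v))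
       (set (krylov_seq A v (Suc m)))"

(* Indices start at 0, so e_1 is unit_vec m 0 and e_m is unit_vec m (m - 1).
   In the order on complex numbers used here, z > 0 means that z is real and positive. *)
definition krylov_decomposition ::
  "complex mat \<Rightarrow> complex vec \<Rightarrow> nat \<Rightarrow> complex mat \<Rightarrow> complex mat \<Rightarrow> real \<Rightarrow> complex vec \<Rightarrow> bool"
where
  "krylov_decomposition A v m V T \<tau> w \<longleftrightarrow>
     V \<in> carrier_mat (dim_vec v) m \<and> T \<in> carrier_mat m m \<and> w \<in> carrier_vec (dim_vec v) \<and>
     mat_adjoint V * V = 1\<^sub>m m \<and>
     LinearCombinations.module.span class_ring (module_vec TYPE(complex) (dim_vec v))
       (set (cols V)) = krylov_space A v m \<and>
     V *\<^sub>v unit_vec m 0 = v \<and>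
     T = mat_adjoint V * A * V \<and>
     (\<forall>i<m. \<forall>j<m. Suc j < i \<longrightarrow> T $$ (i, j) = 0) \<and>
     (\<forall>j. Suc j < m \<longrightarrow> T $$ (Suc j, j) > 0) \<and>
     \<tau> > 0 \<and> vec_norm2 w = 1 \<and> mat_adjoint V *\<^sub>v w = 0\<^sub>v m \<and>
     A * V = V * T + complex_of_real \<tau> \<cdot>\<^sub>m outer_prod w (unit_vec m (m - 1))"

(* e_m^* T^(m-1) e_1 is a complex number; by krylov_gamma_eq below it is real under the
   assumptions on T, so that taking the real part loses nothing. *)
definition krylov_gamma :: "complex mat \<Rightarrow> real" where
  "krylov_gamma T = (let m = dim_row T in
     Re (((T ^\<^sub>m (m - 1)) *\<^sub>v unit_vec m 0) \<bullet>c unit_vec m (m - 1)))"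

definition krylov_error ::
  "complex \<Rightarrow> complex mat \<Rightarrow> complex vec \<Rightarrow> complex mat \<Rightarrow> complex mat \<Rightarrow> real \<Rightarrow> complex vec"
where
  "krylov_error \<sigma> A v V T t =
     mat_exp ((\<sigma> * complex_of_real t) \<cdot>\<^sub>m A) *\<^sub>v v
     - V *\<^sub>v (mat_exp ((\<sigma> * complex_of_real t) \<cdot>\<^sub>m T) *\<^sub>v unit_vec (dim_row T) 0)"

lemma hessenberg_pow_col:
  fixes T :: "complex mat"
  assumes T: "T \<in> carrier_mat m m" and m: "0 < m"
    and hess: "\<forall>i<m. \<forall>j<m. Suc j < i \<longrightarrow> T $$ (i, j) = 0"
    and k: "k < m"
  shows "\<forall>i<m. k < i \<longrightarrow> (T ^\<^sub>m k) $$ (i, 0) = 0"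
    and "(T ^\<^sub>m k) $$ (k, 0) = (\<Prod>j<k. T $$ (Suc j, j))"
proof -
  have "k < m \<Longrightarrow> (\<forall>i<m. k < i \<longrightarrow> (T ^\<^sub>m k) $$ (i, 0) = 0) \<and>
      (T ^\<^sub>m k) $$ (k, 0) = (\<Prod>j<k. T $$ (Suc j, j))"
  proof (induction k)
    case 0
    then show ?case using T m by auto
  next
    case (Suc k)
    have Tk: "T ^\<^sub>m k \<in> carrier_mat m m" using T by (rule pow_carrier_mat)
    have comm: "T ^\<^sub>m Suc k = T * T ^\<^sub>m k"
    proof (induction k)
      case 0
      then show ?case using T by simp
    next
      case (Suc k)
      then show ?case using assoc_mult_mat[OF T pow_carrier_mat[OF T, of k] T] by simp
    qed
    have entry: "(T ^\<^sub>m Suc k) $$ (i, 0) = (\<Sum>l<m. T $$ (i, l) * (T ^\<^sub>m k) $$ (l, 0))"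
      if "i < m" for i
      using that T Tk m unfolding comm by (simp add: scalar_prod_def atLeast0LessThan)
    have zero: "(T ^\<^sub>m Suc k) $$ (i, 0) = 0" if "i < m" "Suc k < i" for i
      unfolding entry[OF that(1)]
    proof (rule sum.neutral, rule ballI)
      fix l assume "l \<in> {..<m}"
      then show "T $$ (i, l) * (T ^\<^sub>m k) $$ (l, 0) = 0"
        using that hess Suc by (cases "k < l") auto
    qed
    have "(T ^\<^sub>m Suc k) $$ (Suc k, 0) = (\<Sum>l\<in>{k}. T $$ (Suc k, l) * (T ^\<^sub>m k) $$ (l, 0))"
      unfolding entry[OF Suc.prems]
    proof (rule sum.mono_neutral_right)
      show "\<forall>l\<in>{..<m} - {k}. T $$ (Suc k, l) * (T ^\<^sub>m k) $$ (l, 0) = 0"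
      proof
        fix l assume "l \<in> {..<m} - {k}"
        then show "T $$ (Suc k, l) * (T ^\<^sub>m k) $$ (l, 0) = 0"
          using hess Suc by (cases "k < l") auto
      qed
    qed (use Suc in auto)
    then show ?case using zero Suc by simp
  qed
  then show "\<forall>i<m. k < i \<longrightarrow> (T ^\<^sub>m k) $$ (i, 0) = 0"
    and "(T ^\<^sub>m k) $$ (k, 0) = (\<Prod>j<k. T $$ (Suc j, j))" using k by auto
qed

lemma krylov_gamma_eq:
  assumes K: "krylov_decomposition A v m V T \<tau> w" and m: "1 \<le> m"
  shows "complex_of_real (krylov_gamma T) =
           ((T ^\<^sub>m (m - 1)) *\<^sub>v unit_vec m 0) \<bullet>c unit_vec m (m - 1)"
    and "complex_of_real (krylov_gamma T) = (\<Prod>j<m - 1. T $$ (Suc j, j))"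
    and "krylov_gamma T > 0"
proof -
  let ?x = "((T ^\<^sub>m (m - 1)) *\<^sub>v unit_vec m 0) \<bullet>c unit_vec m (m - 1)"
  have T: "T \<in> carrier_mat m m"
    and hess: "\<forall>i<m. \<forall>j<m. Suc j < i \<longrightarrow> T $$ (i, j) = 0"
    and pos: "\<forall>j. Suc j < m \<longrightarrow> T $$ (Suc j, j) > 0"
    using K unfolding krylov_decomposition_def by auto
  have Tp: "T ^\<^sub>m (m - 1) \<in> carrier_mat m m" using T by (rule pow_carrier_mat)
  have conj: "conjugate (unit_vec m (m - 1)) = (unit_vec m (m - 1) :: complex vec)"
    by (rule eq_vecI) (auto simp: unit_vec_def)
  have "?x = (T ^\<^sub>m (m - 1)) $$ (m - 1, 0)"
    using carrier_matD[OF Tp] m row_carrier_vec[of "m - 1" m, OF _ Tp] unfolding conj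
    by (simp add: scalar_prod_right_unit[where n = m] del: pow_mat_dim)
  also have "\<dots> = (\<Prod>j<m - 1. T $$ (Suc j, j))"
    using hessenberg_pow_col(2)[OF T _ hess, of "m - 1"] m by auto
  finally have x: "?x = (\<Prod>j<m - 1. T $$ (Suc j, j))" .
  have "(\<Prod>j<m - 1. T $$ (Suc j, j)) = (\<Prod>j<m - 1. complex_of_real (Re (T $$ (Suc j, j))))"
    using pos by (intro prod.cong) (auto simp: less_complex_def complex_eq_iff)
  then have xr: "?x = complex_of_real (\<Prod>j<m - 1. Re (T $$ (Suc j, j)))"
    using x by simp
  have g: "krylov_gamma T = Re ?x"
    using T by (simp add: krylov_gamma_def Let_def)
  show "complex_of_real (krylov_gamma T) = ?x" unfolding g xr by simp
  then show "complex_of_real (krylov_gamma T) = (\<Prod>j<m - 1. T $$ (Suc j, j))" using x by simp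
  show "krylov_gamma T > 0"
    unfolding g xr Re_complex_of_real using pos by (intro prod_pos) (auto simp: less_complex_def)
qed

end

theory Submission
  imports Defs "HOL-Analysis.L2_Norm"
begin

text \<open>
The error $L(t) = e^{\sigma tA}v - V_m e^{\sigma tT_m}e_1$ solves $L' = \sigma A L +
\sigma\tau_{m+1,m}\,(e_m^* e^{\sigma tT_m}e_1)\,v_{m+1}$ with $L(0) = 0$ (lemma
\<open>error_has_vector_derivative\<close>). Both halves of the claim come from this defect.

For the upper bound, the sign of the logarithmic norm makes $\sigma A$ dissipative, that is,
$\mathrm{Re}\langle \sigma Ax, x\rangle \le 0$ (\<open>Re_cscalar_prod_le_log_norm2\<close>). The homogeneous
part therefore never increases the norm, and $\|L(t)\|$ is at most the integral of the norm of the
forcing (\<open>L2_growth_le\<close>). It remains to show $|e_m^* e^{\sigma tT_m}e_1| \le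
\gamma_m t^{m-1}/(m-1)!$ (\<open>hessenberg_exp_last_entry_le\<close>). The compression $\sigma T_m$ is
again dissipative, so its eigenvalues lie in the left half plane. Applying the factors of its
characteristic polynomial one by one turns the corner entry into the top of a chain of $m$ scalar
equations. The bottom one has an initial value of modulus $\gamma_m$, each of the others starts at
zero and integrates its predecessor, and the same growth estimate applies to each of them.

For the asymptotics, the power series of $L$ is compared term by term. The recurrence
$AV_m = V_mT_m + \tau_{m+1,m}v_{m+1}e_m^*$ and the Hessenberg shape give $A^kv = V_mT_m^ke_1$ for
$k < m$ and $A^mv = V_mT_m^me_1 + \tau_{m+1,m}\gamma_m v_{m+1}$ (\<open>pow_start_eq\<close>). Hence
$L(t) = \sigma^m\tau_{m+1,m}\gamma_m\frac{t^m}{m!}v_{m+1} + O(t^{m+1})$, and $v_{m+1}$ is a unit vector.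
\<close>

section \<open>The Euclidean norm and the Hermitian inner product\<close>

lemma vec_norm2_eq_L2_set: "vec_norm2 x = L2_set (\<lambda>i. cmod (x $ i)) {..<dim_vec x}"
  by (simp add: vec_norm2_def L2_set_def)

lemma vec_norm2_nonneg [simp]: "0 \<le> vec_norm2 x"
  by (simp add: vec_norm2_eq_L2_set)

lemma cscalar_prod_sum:
  fixes x y :: "complex vec"
  assumes "dim_vec y = n"
  shows "x \<bullet>c y = (\<Sum>i<n. x $ i * cnj (y $ i))"
  using assms by (simp add: scalar_prod_def atLeast0LessThan conjugate_complex_def)

lemma cscalar_prod_self:
  fixes x :: "complex vec"
  shows "x \<bullet>c x = complex_of_real ((vec_norm2 x)\<^sup>2)"
proof -
  have "x \<bullet>c x = (\<Sum>i<dim_vec x. complex_of_real ((cmod (x $ i))\<^sup>2))"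
    by (simp add: cscalar_prod_sum[OF refl] complex_norm_square[symmetric])
  also have "\<dots> = complex_of_real ((vec_norm2 x)\<^sup>2)"
    by (simp add: vec_norm2_def sum_nonneg)
  finally show ?thesis .
qed

lemma cmod_cscalar_prod_le:
  fixes x y :: "complex vec"
  assumes "dim_vec x = dim_vec y"
  shows "cmod (x \<bullet>c y) \<le> vec_norm2 x * vec_norm2 y"
proof -
  have "cmod (x \<bullet>c y) \<le> (\<Sum>i<dim_vec y. \<bar>cmod (x $ i)\<bar> * \<bar>cmod (y $ i)\<bar>)"
    unfolding cscalar_prod_sum[OF refl]
    by (rule order.trans[OF norm_sum]) (simp add: norm_mult)
  also have "\<dots> \<le> vec_norm2 x * vec_norm2 y"
    unfolding vec_norm2_eq_L2_set assms by (rule L2_set_mult_ineq)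
  finally show ?thesis .
qed

lemma vec_norm2_smult: "vec_norm2 (c \<cdot>\<^sub>v x) = cmod c * vec_norm2 x"
  proof -
  have "vec_norm2 (c \<cdot>\<^sub>v x) = L2_set (\<lambda>i. cmod c * cmod (x $ i)) {..<dim_vec x}"
    unfolding vec_norm2_eq_L2_set by (intro L2_set_cong) (auto simp: norm_mult)
  then show ?thesis by (simp add: vec_norm2_eq_L2_set L2_set_right_distrib)
qed

lemma vec_norm2_triangle:
  assumes "dim_vec x = dim_vec y"
  shows "vec_norm2 (x + y) \<le> vec_norm2 x + vec_norm2 y"
proof -
  have "vec_norm2 (x + y) \<le> L2_set (\<lambda>i. cmod (x $ i) + cmod (y $ i)) {..<dim_vec y}"
    using assms unfolding vec_norm2_eq_L2_set by (auto intro!: L2_set_mono norm_triangle_ineq)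
  also have "\<dots> \<le> vec_norm2 x + vec_norm2 y"
    unfolding vec_norm2_eq_L2_set assms by (rule L2_set_triangle_ineq)
  finally show ?thesis .
qed

lemma vec_norm2_eq_0_iff:
  assumes "x \<in> carrier_vec n"
  shows "vec_norm2 x = 0 \<longleftrightarrow> x = 0\<^sub>v n"
  using assms by (auto simp: vec_norm2_eq_L2_set L2_set_eq_0_iff)

text \<open>A supremum of reals is an upper bound only of a bounded set; the sum of the moduli of all entries
bounds this one.\<close>

lemma vec_norm2_mult_le_mat_norm2:
  assumes B: "B \<in> carrier_mat k n" and x: "x \<in> carrier_vec n" and x1: "vec_norm2 x = 1"
  shows "vec_norm2 (B *\<^sub>v x) \<le> mat_norm2 B"
proof -
  have "vec_norm2 (B *\<^sub>v y) \<le> (\<Sum>i<k. \<Sum>j<n. cmod (B $$ (i, j)))"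
    if y: "y \<in> carrier_vec n" "vec_norm2 y = 1" for y
  proof -
    have y1: "cmod (y $ j) \<le> 1" if "j < n" for j
      using member_le_L2_set[of "{..<n}" j "\<lambda>i. cmod (y $ i)"] y that
      by (simp add: vec_norm2_eq_L2_set)
    have "vec_norm2 (B *\<^sub>v y) \<le> (\<Sum>i<k. cmod ((B *\<^sub>v y) $ i))"
      using B L2_set_le_sum[of "{..<k}" "\<lambda>i. cmod ((B *\<^sub>v y) $ i)"]
      by (simp add: vec_norm2_eq_L2_set del: index_mult_mat_vec)
    also have "\<dots> \<le> (\<Sum>i<k. \<Sum>j<n. cmod (B $$ (i, j)))"
    proof (rule sum_mono)
      fix i assume i: "i \<in> {..<k}"
      have "cmod ((B *\<^sub>v y) $ i) = cmod (\<Sum>j<n. B $$ (i, j) * y $ j)"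
        using i B y by (simp add: scalar_prod_def atLeast0LessThan)
      also have "\<dots> \<le> (\<Sum>j<n. cmod (B $$ (i, j)))"
        using y1 by (intro sum_norm_le) (simp add: norm_mult mult_left_le)
      finally show "cmod ((B *\<^sub>v y) $ i) \<le> (\<Sum>j<n. cmod (B $$ (i, j)))" .
    qed
    finally show ?thesis .
  qed
  then have "bdd_above ((\<lambda>x. vec_norm2 (B *\<^sub>v x)) ` {x \<in> carrier_vec (dim_col B). vec_norm2 x = 1})"
    using B by (intro bdd_aboveI2) auto
  then show ?thesis
    unfolding mat_norm2_def using B x x1 by (intro cSUP_upper) auto
qed

section \<open>The logarithmic norm bounds the field of values\<close>

lemma shift_mult_vec:
  fixes M :: "complex mat"
  assumes "M \<in> carrier_mat n n" "x \<in> carrier_vec n"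
  shows "(1\<^sub>m n + c \<cdot>\<^sub>m M) *\<^sub>v x = x + c \<cdot>\<^sub>v (M *\<^sub>v x)"
proof -
  have "(c \<cdot>\<^sub>m M) *\<^sub>v x = c \<cdot>\<^sub>v (M *\<^sub>v x)"
    using assms by (intro eq_vecI) auto
  then show ?thesis using assms by (simp add: add_mult_distrib_mat_vec[of _ n n])
qed

text \<open>Cauchy--Schwarz: for a unit vector $x$, $1 + h\,\mathrm{Re}\langle Mx, x\rangle =
\mathrm{Re}\langle (I + hM)x, x\rangle \le \|I + hM\|$.\<close>

lemma Re_cscalar_prod_le_log_norm2_quotient:
  assumes M: "M \<in> carrier_mat n n" and x: "x \<in> carrier_vec n" "vec_norm2 x = 1"
    and h: "(0::real) < h"
  shows "Re ((M *\<^sub>v x) \<bullet>c x) \<le> (mat_norm2 (1\<^sub>m n + complex_of_real h \<cdot>\<^sub>m M) - 1) / h"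
proof -
  let ?B = "1\<^sub>m n + complex_of_real h \<cdot>\<^sub>m M"
  have "(?B *\<^sub>v x) \<bullet>c x = x \<bullet>c x + complex_of_real h * ((M *\<^sub>v x) \<bullet>c x)"
    using M x unfolding shift_mult_vec[OF M x(1)]
    by (simp add: cscalar_prod_sum[of _ n] sum.distrib sum_distrib_left algebra_simps)
  then have "1 + h * Re ((M *\<^sub>v x) \<bullet>c x) = Re ((?B *\<^sub>v x) \<bullet>c x)"
    by (simp add: cscalar_prod_self x)
  also have "\<dots> \<le> vec_norm2 (?B *\<^sub>v x)"
    using cmod_cscalar_prod_le[of "?B *\<^sub>v x" x] complex_Re_le_cmod[of "(?B *\<^sub>v x) \<bullet>c x"] M x by simp
  also have "\<dots> \<le> mat_norm2 ?B"
    using M x by (intro vec_norm2_mult_le_mat_norm2[of _ n n]) auto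
  finally show ?thesis using h by (simp add: field_simps)
qed

text \<open>$I + hM$ is the convex combination of $I$ and $I + kM$ with weights $1 - h/k$ and $h/k$.\<close>

lemma log_norm2_quotient_mono:
  assumes M: "M \<in> carrier_mat n n" and n: "0 < n" and h: "(0::real) < h" "h \<le> k"
  shows "(mat_norm2 (1\<^sub>m n + complex_of_real h \<cdot>\<^sub>m M) - 1) / h
      \<le> (mat_norm2 (1\<^sub>m n + complex_of_real k \<cdot>\<^sub>m M) - 1) / k"
proof -
  let ?B = "\<lambda>h. 1\<^sub>m n + complex_of_real h \<cdot>\<^sub>m M"
  have k: "0 < k" using h by simp
  have "mat_norm2 (?B h) \<le> (1 - h / k) + h / k * mat_norm2 (?B k)"
    unfolding mat_norm2_def[of "?B h"]
  proof (rule cSUP_least)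
    have "vec_norm2 (unit_vec n 0) = 1"
      using n by (simp add: vec_norm2_def if_distrib[of cmod] if_distrib[of "\<lambda>x. x\<^sup>2"] cong: if_cong)
    then show "{x \<in> carrier_vec (dim_col (?B h)). vec_norm2 x = 1} \<noteq> {}"
      using M unit_vec_carrier[of n 0] by fastforce
  next
    fix x assume "x \<in> {x \<in> carrier_vec (dim_col (?B h)). vec_norm2 x = 1}"
    then have x: "x \<in> carrier_vec n" "vec_norm2 x = 1" using M by auto
    have "?B h *\<^sub>v x = complex_of_real (1 - h / k) \<cdot>\<^sub>v x + complex_of_real (h / k) \<cdot>\<^sub>v (?B k *\<^sub>v x)"
      unfolding shift_mult_vec[OF M x(1)] using M x k
      by (intro eq_vecI) (auto simp: field_simps)
    then have "vec_norm2 (?B h *\<^sub>v x) \<le> cmod (complex_of_real (1 - h / k)) * vec_norm2 x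
        + cmod (complex_of_real (h / k)) * vec_norm2 (?B k *\<^sub>v x)"
      unfolding \<open>?B h *\<^sub>v x = _\<close> vec_norm2_smult[symmetric]
      using M x by (intro vec_norm2_triangle) simp
    also have "\<dots> = (1 - h / k) + h / k * vec_norm2 (?B k *\<^sub>v x)"
      using h k x unfolding norm_of_real by simp
    also have "\<dots> \<le> (1 - h / k) + h / k * mat_norm2 (?B k)"
      using M x h k by (intro add_left_mono mult_left_mono vec_norm2_mult_le_mat_norm2[of _ n n]) auto
    finally show "vec_norm2 (?B h *\<^sub>v x) \<le> (1 - h / k) + h / k * mat_norm2 (?B k)" .
  qed
  then have "mat_norm2 (?B h) - 1 \<le> (mat_norm2 (?B k) - 1) / k * h"
    by (simp add: diff_divide_distrib algebra_simps)
  then show ?thesis using h by (simp add: pos_divide_le_eq)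
qed

text \<open>The logarithmic norm is a value of \<^const>\<open>Lim\<close>, which says nothing until convergence is known.
Monotonicity of the difference quotient (convexity of the norm) supplies it.\<close>

lemma monotone_tendsto_at_right:
  fixes q :: "real \<Rightarrow> real"
  assumes mono: "\<And>h k. 0 < h \<Longrightarrow> h \<le> k \<Longrightarrow> q h \<le> q k" and bdd: "\<And>h. 0 < h \<Longrightarrow> b \<le> q h"
  shows "(q \<longlongrightarrow> Inf (q ` {0<..})) (at_right 0)"
proof (rule order_tendstoI)
  have bb: "bdd_below (q ` {0<..})" using bdd by (intro bdd_belowI2[of _ b]) auto
  fix a assume a: "a < Inf (q ` {0<..})"
  show "\<forall>\<^sub>F h in at_right 0. a < q h"
    using eventually_at_right_less
  proof eventually_elim
    case (elim h)
    then show ?case using cINF_lower[OF bb, of h] a by simp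
  qed
next
  have bb: "bdd_below (q ` {0<..})" using bdd by (intro bdd_belowI2[of _ b]) auto
  fix a assume "Inf (q ` {0<..}) < a"
  then obtain k where k: "0 < k" "q k < a"
    using cINF_less_iff[OF _ bb] by auto
  show "\<forall>\<^sub>F h in at_right 0. q h < a"
    using eventually_at_right_real[OF k(1)]
  proof eventually_elim
    case (elim h)
    then show ?case using mono[of h k] k by simp
  qed
qed

text \<open>The bridge from the logarithmic norm to the field of values. The bound for every difference quotient
passes to the limit, and homogeneity extends it from unit vectors to all vectors.\<close>

lemma Re_cscalar_prod_le_log_norm2:
  assumes M: "M \<in> carrier_mat n n" and x: "x \<in> carrier_vec n"
  shows "Re ((M *\<^sub>v x) \<bullet>c x) \<le> log_norm2 M * (vec_norm2 x)\<^sup>2"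
proof (cases "vec_norm2 x = 0")
  case True
  then have "(M *\<^sub>v x) \<bullet>c x = 0"
    using cmod_cscalar_prod_le[of "M *\<^sub>v x" x] M x by simp
  then show ?thesis using True by simp
next
  case False
  define N where "N = vec_norm2 x"
  have N: "0 < N" using False vec_norm2_nonneg[of x] unfolding N_def by linarith
  have n: "0 < n" using False x by (cases n) (auto simp: vec_norm2_def)
  define q where "q = (\<lambda>h::real. (mat_norm2 (1\<^sub>m n + complex_of_real h \<cdot>\<^sub>m M) - 1) / h)"
  define y where "y = complex_of_real (1 / N) \<cdot>\<^sub>v x"
  have y: "y \<in> carrier_vec n" "vec_norm2 y = 1"
    unfolding y_def vec_norm2_smult norm_of_real using x N by (auto simp: N_def[symmetric])
  have le: "Re ((M *\<^sub>v y) \<bullet>c y) \<le> q h" if "0 < h" for h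
    unfolding q_def by (rule Re_cscalar_prod_le_log_norm2_quotient[OF M y that])
  have lim: "(q \<longlongrightarrow> Inf (q ` {0<..})) (at_right 0)"
    using le log_norm2_quotient_mono[OF M n] unfolding q_def by (intro monotone_tendsto_at_right) auto
  have "log_norm2 M = Inf (q ` {0<..})"
    using tendsto_Lim[OF _ lim] M unfolding log_norm2_def q_def by simp
  moreover have "Re ((M *\<^sub>v y) \<bullet>c y) \<le> Inf (q ` {0<..})"
    using le by (intro cINF_greatest) auto
  moreover have "(M *\<^sub>v y) \<bullet>c y = complex_of_real (1 / N\<^sup>2) * ((M *\<^sub>v x) \<bullet>c x)"
    using M x unfolding y_def
    by (simp add: mult_mat_vec[of _ n n] cscalar_prod_sum[of _ n] sum_distrib_left power2_eq_square)
  ultimately have "Re ((M *\<^sub>v x) \<bullet>c x) / N\<^sup>2 \<le> log_norm2 M" by simp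
  then show ?thesis using N by (simp add: N_def field_simps)
qed

section \<open>Dissipative matrices\<close>

definition dissipative :: "complex mat \<Rightarrow> bool" where
  "dissipative M \<longleftrightarrow> (\<forall>x\<in>carrier_vec (dim_row M). Re ((M *\<^sub>v x) \<bullet>c x) \<le> 0)"

text \<open>Test dissipativity on an eigenvector $x$: $\langle Mx, x\rangle = l\,\|x\|^2$.\<close>

lemma dissipative_eigenvalue:
  assumes M: "M \<in> carrier_mat n n" and diss: "dissipative M" and ev: "eigenvalue M l"
  shows "Re l \<le> 0"
proof -
  from ev obtain x where x: "x \<in> carrier_vec n" "x \<noteq> 0\<^sub>v n" "M *\<^sub>v x = l \<cdot>\<^sub>v x"
    using M unfolding eigenvalue_def eigenvector_def by auto
  have "(M *\<^sub>v x) \<bullet>c x = l * (x \<bullet>c x)" using x by simp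
  then have "Re ((M *\<^sub>v x) \<bullet>c x) = Re l * (vec_norm2 x)\<^sup>2" by (simp add: cscalar_prod_self)
  moreover have "Re ((M *\<^sub>v x) \<bullet>c x) \<le> 0" using diss x M unfolding dissipative_def by auto
  moreover have "0 < (vec_norm2 x)\<^sup>2" using x vec_norm2_eq_0_iff by simp
  ultimately show ?thesis by (simp add: mult_le_0_iff)
qed

lemma cscalar_prod_mat_adjoint:
  fixes V :: "complex mat"
  assumes "V \<in> carrier_mat n m" "x \<in> carrier_vec n" "y \<in> carrier_vec m"
  shows "(mat_adjoint V *\<^sub>v x) \<bullet>c y = x \<bullet>c (V *\<^sub>v y)"
proof -
  have "(mat_adjoint V *\<^sub>v x) \<bullet>c y = (\<Sum>j<m. \<Sum>i<n. cnj (V $$ (i, j)) * x $ i * cnj (y $ j))"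
    using assms
    by (simp add: cscalar_prod_sum[of _ m] mat_adjoint_def scalar_prod_def atLeast0LessThan
        conjugate_complex_def sum_distrib_right mat_of_rows_row)
  also have "\<dots> = (\<Sum>i<n. \<Sum>j<m. cnj (V $$ (i, j)) * x $ i * cnj (y $ j))"
    by (rule sum.swap)
  also have "\<dots> = x \<bullet>c (V *\<^sub>v y)"
    using assms
    by (simp add: cscalar_prod_sum[of _ n] scalar_prod_def atLeast0LessThan
        sum_distrib_left mult_ac)
  finally show ?thesis .
qed

text \<open>The quadratic form of the compression at $y$ is the quadratic form of $M$ at $Vy$, so its sign is
inherited.\<close>

lemma dissipative_compression:
  assumes M: "M \<in> carrier_mat n n" and V: "V \<in> carrier_mat n m" and diss: "dissipative M"
  shows "dissipative (mat_adjoint V * M * V)"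
proof -
  have adj: "mat_adjoint V \<in> carrier_mat m n" using V by (auto simp: mat_adjoint_def)
  have "Re ((mat_adjoint V * M * V *\<^sub>v y) \<bullet>c y) \<le> 0" if y: "y \<in> carrier_vec m" for y
  proof -
    have Vy: "V *\<^sub>v y \<in> carrier_vec n" and MVy: "M *\<^sub>v (V *\<^sub>v y) \<in> carrier_vec n" using M V y by auto
    have "mat_adjoint V * M * V *\<^sub>v y = mat_adjoint V *\<^sub>v (M *\<^sub>v (V *\<^sub>v y))"
      unfolding assoc_mult_mat_vec[OF mult_carrier_mat[OF adj M] V y] by (rule assoc_mult_mat_vec[OF adj M Vy])
    then have "(mat_adjoint V * M * V *\<^sub>v y) \<bullet>c y = (M *\<^sub>v (V *\<^sub>v y)) \<bullet>c (V *\<^sub>v y)"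
      using cscalar_prod_mat_adjoint[OF V MVy y] by simp
    then show ?thesis using diss Vy M unfolding dissipative_def by auto
  qed
  then show ?thesis using adj unfolding dissipative_def by auto
qed

section \<open>The flow of a matrix as a power series\<close>

lemma mult_mat_vec_nth_sum:
  fixes M :: "complex mat"
  assumes "M \<in> carrier_mat k n" "x \<in> carrier_vec n" "i < k"
  shows "(M *\<^sub>v x) $ i = (\<Sum>j<n. M $$ (i, j) * x $ j)"
  using assms by (simp add: scalar_prod_def atLeast0LessThan)

lemma smult_pow_mat:
  fixes M :: "complex mat"
  assumes M: "M \<in> carrier_mat n n"
  shows "(c \<cdot>\<^sub>m M) ^\<^sub>m k = c ^ k \<cdot>\<^sub>m (M ^\<^sub>m k)"
proof (induction k)
  case 0
  show ?case using M by (intro eq_matI) auto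
next
  case (Suc k)
  have "M ^\<^sub>m k \<in> carrier_mat n n" using M by (rule pow_carrier_mat)
  then have "(c ^ k \<cdot>\<^sub>m (M ^\<^sub>m k)) * (c \<cdot>\<^sub>m M) = c \<cdot>\<^sub>m (c ^ k \<cdot>\<^sub>m (M ^\<^sub>m k * M))"
    using M by (simp add: mult_smult_distrib[of _ n n] mult_smult_assoc_mat[of _ n n])
  also have "\<dots> = c ^ Suc k \<cdot>\<^sub>m (M ^\<^sub>m k * M)"
    by (intro eq_matI) auto
  finally show ?case using Suc by simp
qed

lemma pow_mat_Suc_mult_vec_right:
  fixes M :: "complex mat"
  assumes M: "M \<in> carrier_mat n n" and x: "x \<in> carrier_vec n"
  shows "M ^\<^sub>m Suc k *\<^sub>v x = M ^\<^sub>m k *\<^sub>v (M *\<^sub>v x)"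
  using assoc_mult_mat_vec[OF pow_carrier_mat[OF M] M x] by simp

lemma pow_mat_Suc_mult_vec_left:
  fixes M :: "complex mat"
  assumes M: "M \<in> carrier_mat n n" and x: "x \<in> carrier_vec n"
  shows "M ^\<^sub>m Suc k *\<^sub>v x = M *\<^sub>v (M ^\<^sub>m k *\<^sub>v x)"
  using x
proof (induction k arbitrary: x)
  case 0
  then show ?case using M by simp
next
  case (Suc k)
  have "M *\<^sub>v x \<in> carrier_vec n" using M Suc.prems by simp
  then show ?case
    unfolding pow_mat_Suc_mult_vec_right[OF M Suc.prems] by (rule Suc.IH)
qed

text \<open>A crude entrywise bound, good enough to compare the entries of the exponential series with those of
a scalar exponential.\<close>

lemma cmod_pow_mat_le:
  fixes M :: "complex mat"
  assumes M: "M \<in> carrier_mat n n" and b: "\<And>i j. i < n \<Longrightarrow> j < n \<Longrightarrow> cmod (M $$ (i, j)) \<le> b"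
    and ij: "i < n" "j < n"
  shows "cmod ((M ^\<^sub>m k) $$ (i, j)) \<le> (real n * b) ^ k"
  using ij
proof (induction k arbitrary: j)
  case 0
  then show ?case using M by simp
next
  case (Suc k)
  have b0: "0 \<le> b" using b[OF Suc.prems] norm_ge_zero order.trans by blast
  have car: "M ^\<^sub>m k \<in> carrier_mat n n" using M by (rule pow_carrier_mat)
  have "cmod ((M ^\<^sub>m Suc k) $$ (i, j)) = cmod (\<Sum>l<n. (M ^\<^sub>m k) $$ (i, l) * M $$ (l, j))"
    using M car Suc.prems by (simp add: scalar_prod_def atLeast0LessThan del: pow_mat_dim)
  also have "\<dots> \<le> (\<Sum>l<n. (real n * b) ^ k * b)"
    using Suc b b0 by (intro sum_norm_le) (auto simp: norm_mult intro!: mult_mono)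
  also have "\<dots> = (real n * b) ^ Suc k" by simp
  finally show ?case .
qed

lemma pow_mat_exp_series_summable:
  fixes M :: "complex mat"
  assumes M: "M \<in> carrier_mat n n" and ij: "i < n" "j < n"
  shows "summable (\<lambda>k. (M ^\<^sub>m k) $$ (i, j) / fact k * z ^ k)"
proof -
  define b where "b = (\<Sum>i<n. \<Sum>j<n. cmod (M $$ (i, j)))"
  have b: "cmod (M $$ (i, j)) \<le> b" if "i < n" "j < n" for i j
  proof -
    have "cmod (M $$ (i, j)) \<le> (\<Sum>j<n. cmod (M $$ (i, j)))"
      using member_le_sum[of j "{..<n}" "\<lambda>j. cmod (M $$ (i, j))"] that by simp
    also have "\<dots> \<le> b" unfolding b_def
      using member_le_sum[of i "{..<n}" "\<lambda>i. \<Sum>j<n. cmod (M $$ (i, j))"] that by (simp add: sum_nonneg)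
    finally show ?thesis .
  qed
  show ?thesis
  proof (rule summable_comparison_test)
    show "\<exists>N. \<forall>k\<ge>N. norm ((M ^\<^sub>m k) $$ (i, j) / fact k * z ^ k)
        \<le> inverse (fact k) * (real n * b * cmod z) ^ k"
    proof (intro exI[of _ 0] allI impI)
      fix k
      have "norm ((M ^\<^sub>m k) $$ (i, j) / fact k * z ^ k)
          = cmod ((M ^\<^sub>m k) $$ (i, j)) / fact k * cmod z ^ k"
        by (simp only: norm_mult norm_power norm_divide norm_fact)
      also have "\<dots> \<le> (real n * b) ^ k / fact k * cmod z ^ k"
        using cmod_pow_mat_le[OF M _ ij, of b k] b by (intro divide_right_mono mult_right_mono) simp_all
      also have "\<dots> = inverse (fact k) * (real n * b * cmod z) ^ k"
        by (simp only: power_mult_distrib divide_inverse mult_ac)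
      finally show "norm ((M ^\<^sub>m k) $$ (i, j) / fact k * z ^ k)
          \<le> inverse (fact k) * (real n * b * cmod z) ^ k" .
    qed
    show "summable (\<lambda>k. inverse (fact k) * (real n * b * cmod z) ^ k)"
      by (rule summable_exp)
  qed
qed

text \<open>The solution of $u' = Mu$ with initial value $x$.\<close>

definition exp_flow :: "complex mat \<Rightarrow> complex vec \<Rightarrow> real \<Rightarrow> complex vec" where
  "exp_flow M x t = mat_exp (complex_of_real t \<cdot>\<^sub>m M) *\<^sub>v x"

lemma exp_flow_carrier:
  assumes "M \<in> carrier_mat n n"
  shows "exp_flow M x t \<in> carrier_vec n"
  unfolding exp_flow_def mat_exp_def using assms by (intro carrier_vecI) simp

lemma exp_flow_coeff_nth:
  fixes M :: "complex mat"
  assumes "M \<in> carrier_mat n n" "x \<in> carrier_vec n" "i < n"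
  shows "(M ^\<^sub>m k *\<^sub>v x) $ i / fact k * z ^ k
      = (\<Sum>j<n. (M ^\<^sub>m k) $$ (i, j) / fact k * z ^ k * x $ j)"
  unfolding mult_mat_vec_nth_sum[OF pow_carrier_mat[OF assms(1)] assms(2,3)]
  unfolding sum_divide_distrib sum_distrib_right by (intro sum.cong refl) simp

lemma exp_flow_summable:
  fixes M :: "complex mat"
  assumes M: "M \<in> carrier_mat n n" and x: "x \<in> carrier_vec n" and i: "i < n"
  shows "summable (\<lambda>k. (M ^\<^sub>m k *\<^sub>v x) $ i / fact k * z ^ k)"
proof -
  have "summable (\<lambda>k. \<Sum>j<n. (M ^\<^sub>m k) $$ (i, j) / fact k * z ^ k * x $ j)"
    by (intro summable_sum summable_mult2 pow_mat_exp_series_summable[OF M i]) auto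
  then show ?thesis unfolding exp_flow_coeff_nth[OF assms] .
qed

lemma exp_flow_nth:
  assumes M: "M \<in> carrier_mat n n" and x: "x \<in> carrier_vec n" and i: "i < n"
  shows "exp_flow M x t $ i = (\<Sum>k. (M ^\<^sub>m k *\<^sub>v x) $ i / fact k * complex_of_real t ^ k)"
proof -
  have "exp_flow M x t $ i
      = (\<Sum>j<n. (\<Sum>k. ((complex_of_real t \<cdot>\<^sub>m M) ^\<^sub>m k) $$ (i, j) / fact k) * x $ j)"
    using M x i by (simp add: exp_flow_def mat_exp_def scalar_prod_def atLeast0LessThan)
  also have "\<dots> = (\<Sum>j<n. (\<Sum>k. (M ^\<^sub>m k) $$ (i, j) / fact k * complex_of_real t ^ k) * x $ j)"
    using carrier_matD[OF pow_carrier_mat[OF M]] i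
    by (intro sum.cong refl) (simp add: smult_pow_mat[OF M] mult_ac del: pow_mat_dim)
  also have "\<dots> = (\<Sum>j<n. \<Sum>k. (M ^\<^sub>m k) $$ (i, j) / fact k * complex_of_real t ^ k * x $ j)"
    by (intro sum.cong refl suminf_mult2 pow_mat_exp_series_summable[OF M i]) auto
  also have "\<dots> = (\<Sum>k. \<Sum>j<n. (M ^\<^sub>m k) $$ (i, j) / fact k * complex_of_real t ^ k * x $ j)"
    by (intro suminf_sum[symmetric] summable_mult2 pow_mat_exp_series_summable[OF M i]) auto
  finally show ?thesis unfolding exp_flow_coeff_nth[OF assms] .
qed

lemma exp_flow_add:
  assumes "M \<in> carrier_mat n n" "x \<in> carrier_vec n" "y \<in> carrier_vec n"
  shows "exp_flow M (x + y) t = exp_flow M x t + exp_flow M y t"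
  unfolding exp_flow_def using assms
  by (intro mult_add_distrib_mat_vec[of _ n n]) (auto simp: mat_exp_def)

lemma exp_flow_smult:
  assumes "M \<in> carrier_mat n n" "x \<in> carrier_vec n"
  shows "exp_flow M (c \<cdot>\<^sub>v x) t = c \<cdot>\<^sub>v exp_flow M x t"
  unfolding exp_flow_def using assms
  by (intro mult_mat_vec[of _ n n]) (auto simp: mat_exp_def)

lemma exp_flow_zero:
  assumes "M \<in> carrier_mat n n"
  shows "exp_flow M (0\<^sub>v n) t = 0\<^sub>v n"
  unfolding exp_flow_def using assms by (intro eq_vecI) (auto simp: mat_exp_def)

lemma powser_has_vector_derivative:
  fixes c :: "nat \<Rightarrow> complex"
  assumes "\<And>z. summable (\<lambda>k. c k * z ^ k)"
  shows "((\<lambda>t. \<Sum>k. c k * complex_of_real t ^ k) has_vector_derivative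
      (\<Sum>k. diffs c k * complex_of_real t ^ k)) (at t)"
proof -
  let ?f = "\<lambda>z. \<Sum>k. c k * z ^ k"
  have f: "(?f has_derivative (*) (\<Sum>k. diffs c k * complex_of_real t ^ k)) (at (complex_of_real t))"
    using termdiffs_strong_converges_everywhere[OF assms] by (simp add: has_field_derivative_def)
  have "(complex_of_real has_derivative complex_of_real) (at t)"
    using has_derivative_of_real[OF has_derivative_ident] .
  then have "((\<lambda>t. ?f (complex_of_real t)) has_derivative
      (\<lambda>h. (\<Sum>k. diffs c k * complex_of_real t ^ k) * complex_of_real h)) (at t)"
    using f by (rule has_derivative_compose)
  then show ?thesis
    by (simp add: has_vector_derivative_def scaleR_conv_of_real mult.commute)
qed

lemma mult_exp_flow_summable:
  fixes M B :: "complex mat"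
  assumes M: "M \<in> carrier_mat n n" and x: "x \<in> carrier_vec n"
    and B: "B \<in> carrier_mat p n" and i: "i < p"
  shows "summable (\<lambda>k. (B *\<^sub>v (M ^\<^sub>m k *\<^sub>v x)) $ i / fact k * z ^ k)"
proof -
  have pk: "M ^\<^sub>m k *\<^sub>v x \<in> carrier_vec n" for k
    using pow_carrier_mat[OF M] x by (rule mult_mat_vec_carrier)
  have "summable (\<lambda>k. \<Sum>j<n. B $$ (i, j) * ((M ^\<^sub>m k *\<^sub>v x) $ j / fact k * z ^ k))"
    using exp_flow_summable[OF M x] by (intro summable_sum summable_mult) auto
  then show ?thesis
    unfolding mult_mat_vec_nth_sum[OF B pk i]
    by (simp only: sum_divide_distrib sum_distrib_right times_divide_eq_left times_divide_eq_right mult.assoc)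
qed

text \<open>A fixed matrix passes through the exponential series. With $B = M$ this shows that $M$ commutes with
its flow; with $B = V_m$ it turns the Krylov approximation into a power series whose coefficients
can be compared with those of the exact solution.\<close>

lemma mult_exp_flow_nth:
  assumes M: "M \<in> carrier_mat n n" and x: "x \<in> carrier_vec n"
    and B: "B \<in> carrier_mat p n" and i: "i < p"
  shows "(B *\<^sub>v exp_flow M x t) $ i
      = (\<Sum>k. (B *\<^sub>v (M ^\<^sub>m k *\<^sub>v x)) $ i / fact k * complex_of_real t ^ k)"
proof -
  have pk: "M ^\<^sub>m k *\<^sub>v x \<in> carrier_vec n" for k
    using pow_carrier_mat[OF M] x by (rule mult_mat_vec_carrier)
  have "(B *\<^sub>v exp_flow M x t) $ i
      = (\<Sum>j<n. B $$ (i, j) * (\<Sum>k. (M ^\<^sub>m k *\<^sub>v x) $ j / fact k * complex_of_real t ^ k))"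
    unfolding mult_mat_vec_nth_sum[OF B exp_flow_carrier[OF M] i]
    by (intro sum.cong refl) (simp add: exp_flow_nth[OF M x])
  also have "\<dots> = (\<Sum>j<n. \<Sum>k. B $$ (i, j) * ((M ^\<^sub>m k *\<^sub>v x) $ j / fact k * complex_of_real t ^ k))"
    using exp_flow_summable[OF M x] by (intro sum.cong refl suminf_mult[symmetric]) auto
  also have "\<dots> = (\<Sum>k. \<Sum>j<n. B $$ (i, j) * ((M ^\<^sub>m k *\<^sub>v x) $ j / fact k * complex_of_real t ^ k))"
    using exp_flow_summable[OF M x] by (intro suminf_sum[symmetric] summable_mult) auto
  finally show ?thesis
    unfolding mult_mat_vec_nth_sum[OF B pk i]
    by (simp only: sum_divide_distrib sum_distrib_right times_divide_eq_left times_divide_eq_right mult.assoc)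
qed

lemma exp_flow_mult_vec:
  assumes M: "M \<in> carrier_mat n n" and x: "x \<in> carrier_vec n"
  shows "exp_flow M (M *\<^sub>v x) t = M *\<^sub>v exp_flow M x t"
proof (rule eq_vecI)
  fix i assume "i < dim_vec (M *\<^sub>v exp_flow M x t)"
  then have i: "i < n" using M by simp
  have Mx: "M *\<^sub>v x \<in> carrier_vec n" using M x by simp
  show "exp_flow M (M *\<^sub>v x) t $ i = (M *\<^sub>v exp_flow M x t) $ i"
    unfolding exp_flow_nth[OF M Mx i] mult_exp_flow_nth[OF M x M i]
    by (simp only: pow_mat_Suc_mult_vec_left[OF M x, symmetric] pow_mat_Suc_mult_vec_right[OF M x, symmetric])
qed (use exp_flow_carrier[OF M] M in auto)

lemma exp_flow_has_vector_derivative: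
  assumes M: "M \<in> carrier_mat n n" and x: "x \<in> carrier_vec n" and i: "i < n"
  shows "((\<lambda>t. exp_flow M x t $ i) has_vector_derivative exp_flow M (M *\<^sub>v x) t $ i) (at t)"
proof -
  have Mx: "M *\<^sub>v x \<in> carrier_vec n" using M x by simp
  have "diffs (\<lambda>k. (M ^\<^sub>m k *\<^sub>v x) $ i / fact k) k = (M ^\<^sub>m k *\<^sub>v (M *\<^sub>v x)) $ i / fact k" for k
    unfolding pow_mat_Suc_mult_vec_right[OF M x, symmetric] diffs_def
    by (simp del: pow_mat.simps of_nat_Suc)
  then show ?thesis
    using powser_has_vector_derivative[OF exp_flow_summable[OF M x i], of t]
    by (simp add: exp_flow_nth[OF M x i] exp_flow_nth[OF M Mx i])
qed

lemma exp_flow_0: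
  assumes M: "M \<in> carrier_mat n n" and x: "x \<in> carrier_vec n"
  shows "exp_flow M x 0 = x"
proof (rule eq_vecI)
  fix i assume "i < dim_vec x"
  then have i: "i < n" using x by simp
  have "exp_flow M x 0 $ i = (\<Sum>k. (M ^\<^sub>m k *\<^sub>v x) $ i / fact k * 0 ^ k)"
    unfolding exp_flow_nth[OF M x i] of_real_0 ..
  also have "\<dots> = (M ^\<^sub>m 0 *\<^sub>v x) $ i / fact 0" by (rule powser_zero)
  also have "\<dots> = x $ i" using M x by simp
  finally show "exp_flow M x 0 $ i = x $ i" .
qed (use exp_flow_carrier[OF M] x in auto)

text \<open>Since the series of moduli at $1$ converges, it serves as a constant that is uniform on $[0, 1]$.\<close>

lemma powser_remainder_le:
  fixes c :: "nat \<Rightarrow> complex"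
  assumes sm: "\<And>z. summable (\<lambda>k. c k * z ^ k)"
  obtains C where "\<And>t. 0 \<le> t \<Longrightarrow> t \<le> 1 \<Longrightarrow>
    cmod ((\<Sum>k. c k * complex_of_real t ^ k) - (\<Sum>k<N. c k * complex_of_real t ^ k)) \<le> C * t ^ N"
proof
  fix t :: real assume t: "0 \<le> t" "t \<le> 1"
  let ?z = "complex_of_real t"
  have abs: "summable (\<lambda>k. cmod (c (k + N)))"
    using powser_insidea[OF sm[of 2], of 1] by (subst summable_iff_shift) simp
  have "(\<Sum>k. c k * ?z ^ k) - (\<Sum>k<N. c k * ?z ^ k) = (\<Sum>k. c (k + N) * ?z ^ (k + N))"
    using suminf_split_initial_segment[OF sm[of ?z], of N] by simp
  moreover have "cmod (\<Sum>k. c (k + N) * ?z ^ (k + N)) \<le> (\<Sum>k. cmod (c (k + N)) * t ^ N)"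
  proof (rule norm_suminf_le)
    show "summable (\<lambda>k. cmod (c (k + N)) * t ^ N)" using abs by (rule summable_mult2)
    fix k
    have "t ^ (k + N) \<le> t ^ N" using t by (intro power_decreasing) auto
    then show "cmod (c (k + N) * ?z ^ (k + N)) \<le> cmod (c (k + N)) * t ^ N"
      using t by (simp add: norm_mult norm_power mult_left_mono)
  qed
  moreover have "(\<Sum>k. cmod (c (k + N)) * t ^ N) = (\<Sum>k. cmod (c (k + N))) * t ^ N"
    using abs by (rule suminf_mult2[symmetric])
  ultimately show "cmod ((\<Sum>k. c k * ?z ^ k) - (\<Sum>k<N. c k * ?z ^ k)) \<le> (\<Sum>k. cmod (c (k + N))) * t ^ N"
    by simp
qed

section \<open>Growth of dissipative systems with forcing\<close>

lemma has_real_derivative_cmod_sq: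
  assumes "(u has_vector_derivative u') (at t)"
  shows "((\<lambda>t. (cmod (u t))\<^sup>2) has_real_derivative 2 * Re (u' * cnj (u t))) (at t)"
proof -
  have "((\<lambda>t. Re (u t)) has_real_derivative Re u') (at t)" "((\<lambda>t. Im (u t)) has_real_derivative Im u') (at t)"
    using bounded_linear.has_vector_derivative[OF bounded_linear_Re assms]
      bounded_linear.has_vector_derivative[OF bounded_linear_Im assms]
    by (simp_all add: has_real_derivative_iff_has_vector_derivative)
  from DERIV_add[OF DERIV_power[OF this(1), of 2] DERIV_power[OF this(2), of 2]]
  show ?thesis by (simp add: cmod_power2 algebra_simps)
qed

text \<open>A variation-of-constants estimate that needs neither integrals nor the propagator. If $u' = Mu + r$
with $M$ dissipative, then the norm of $u$ grows at a rate of at most $\|r\|$, since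
$\frac{d}{dt}\|u\|^2 = 2\,\mathrm{Re}\langle u', u\rangle \le 2\,\mathrm{Re}\langle r, u\rangle
\le 2\|r\|\,\|u\|$. The dissipative part $u' - r$ appears only through its inner product with $u$.\<close>

lemma L2_growth_le:
  fixes u u' r :: "'i \<Rightarrow> real \<Rightarrow> complex"
  assumes der: "\<And>i t. i \<in> I \<Longrightarrow> 0 \<le> t \<Longrightarrow> (u i has_vector_derivative u' i t) (at t)"
    and diss: "\<And>t. 0 \<le> t \<Longrightarrow> Re (\<Sum>i\<in>I. (u' i t - r i t) * cnj (u i t)) \<le> 0"
    and forcing: "\<And>t. 0 \<le> t \<Longrightarrow> L2_set (\<lambda>i. cmod (r i t)) I \<le> c * t ^ k / fact k"
    and t: "0 \<le> t"
  shows "L2_set (\<lambda>i. cmod (u i t)) I \<le> L2_set (\<lambda>i. cmod (u i 0)) I + c * t ^ Suc k / fact (Suc k)"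
proof (rule field_le_epsilon)
  fix e :: real assume e: "0 < e"
  define N where "N = (\<lambda>t. \<Sum>i\<in>I. (cmod (u i t))\<^sup>2)"
  define N' where "N' = (\<lambda>t. 2 * Re (\<Sum>i\<in>I. u' i t * cnj (u i t)))"
  \<comment> \<open>The norm need not be differentiable at its zeros; the regularisation by e makes it so.\<close>
  define s where "s = (\<lambda>t. sqrt (N t + e\<^sup>2))"
  have L2: "L2_set (\<lambda>i. cmod (u i t)) I = sqrt (N t)" for t
    by (simp add: L2_set_def N_def)
  have N0: "0 \<le> N t" for t by (simp add: N_def sum_nonneg)
  have s_pos: "0 < s t" for t
    using N0[of t] e unfolding s_def by (simp add: add_nonneg_pos)
  have dN: "(N has_real_derivative N' t) (at t)" if "0 \<le> t" for t
    unfolding N_def N'_def Re_sum sum_distrib_left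
    by (intro DERIV_sum has_real_derivative_cmod_sq der that)
  have ds: "(s has_real_derivative N' t / (2 * s t)) (at t)" if "0 \<le> t" for t
  proof -
    have pos: "0 < N t + e\<^sup>2" using N0[of t] e by (simp add: add_nonneg_pos)
    have "((\<lambda>t. N t + e\<^sup>2) has_real_derivative N' t) (at t)"
      using DERIV_add[OF dN[OF that] DERIV_const] by simp
    then have "(s has_real_derivative inverse (s t) / 2 * N' t) (at t)"
      unfolding s_def by (rule DERIV_chain2[where f = sqrt and g = "\<lambda>t. N t + e\<^sup>2" and x = t,
            OF DERIV_real_sqrt[OF pos]])
    moreover have "inverse (s t) / 2 * N' t = N' t / (2 * s t)"
      by (simp add: field_simps)
    ultimately show ?thesis by (simp only:)
  qed
  have s'_le: "N' t / (2 * s t) \<le> c * t ^ k / fact k" if t: "0 \<le> t" for t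
  proof -
    have "N' t = 2 * Re (\<Sum>i\<in>I. (u' i t - r i t) * cnj (u i t)) + 2 * Re (\<Sum>i\<in>I. r i t * cnj (u i t))"
      by (simp add: N'_def left_diff_distrib sum_subtractf)
    also have "\<dots> \<le> 2 * cmod (\<Sum>i\<in>I. r i t * cnj (u i t))"
      using diss[OF t] complex_Re_le_cmod[of "\<Sum>i\<in>I. r i t * cnj (u i t)"] by simp
    also have "cmod (\<Sum>i\<in>I. r i t * cnj (u i t)) \<le> (\<Sum>i\<in>I. \<bar>cmod (r i t)\<bar> * \<bar>cmod (u i t)\<bar>)"
      by (rule order.trans[OF norm_sum]) (simp add: norm_mult)
    also have "\<dots> \<le> L2_set (\<lambda>i. cmod (r i t)) I * sqrt (N t)"
      unfolding L2[symmetric] by (rule L2_set_mult_ineq)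
    also have "\<dots> \<le> c * t ^ k / fact k * s t"
      using forcing[OF t] N0[of t] by (intro mult_mono) (auto simp: s_def intro: order.trans[OF L2_set_nonneg])
    finally show ?thesis using s_pos[of t] by (simp add: pos_divide_le_eq mult_ac)
  qed
  have "s t - c * t ^ Suc k / fact (Suc k) \<le> s 0 - c * 0 ^ Suc k / fact (Suc k)"
  proof (rule DERIV_nonpos_imp_nonincreasing[OF t])
    fix x :: real assume x: "0 \<le> x" "x \<le> t"
    have "((\<lambda>t. c * t ^ Suc k / fact (Suc k)) has_real_derivative c * (real (Suc k) * x ^ k) / fact (Suc k)) (at x)"
      using DERIV_cdivide[OF DERIV_cmult[OF DERIV_pow[of "Suc k" x UNIV], of c], of "fact (Suc k)"]
      by (simp only: diff_Suc_Suc diff_zero)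
    moreover have eq: "c * (real (Suc k) * x ^ k) / fact (Suc k) = c * x ^ k / fact k"
      by (simp del: of_nat_Suc)
    ultimately have "((\<lambda>t. c * t ^ Suc k / fact (Suc k)) has_real_derivative c * x ^ k / fact k) (at x)"
      by (simp only: eq)
    then have "((\<lambda>t. s t - c * t ^ Suc k / fact (Suc k)) has_real_derivative
        N' x / (2 * s x) - c * x ^ k / fact k) (at x)"
      by (intro DERIV_diff ds x)
    then show "\<exists>y. ((\<lambda>t. s t - c * t ^ Suc k / fact (Suc k)) has_real_derivative y) (at x) \<and> y \<le> 0"
      using s'_le[OF x(1)] by (intro exI conjI) auto
  qed
  moreover have "s 0 \<le> sqrt (N 0) + e"
    unfolding s_def using sqrt_add_le_add_sqrt[of "N 0" "e\<^sup>2"] N0[of 0] e by simp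
  moreover have "sqrt (N t) \<le> s t" by (simp add: s_def)
  ultimately show "L2_set (\<lambda>i. cmod (u i t)) I
      \<le> L2_set (\<lambda>i. cmod (u i 0)) I + c * t ^ Suc k / fact (Suc k) + e"
    unfolding L2 by simp
qed

section \<open>The corner entry of the exponential of a Hessenberg matrix\<close>

text \<open>The vectors $(S - l_{k-1})\cdots(S - l_0)\,x$, a Newton-type basis in place of the powers $S^k x$.\<close>

primrec shifted_krylov :: "complex mat \<Rightarrow> (nat \<Rightarrow> complex) \<Rightarrow> complex vec \<Rightarrow> nat \<Rightarrow> complex vec" where
  "shifted_krylov S l x 0 = x"
| "shifted_krylov S l x (Suc k) = S *\<^sub>v shifted_krylov S l x k - l k \<cdot>\<^sub>v shifted_krylov S l x k"

lemma shifted_krylov_carrier: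
  assumes "S \<in> carrier_mat m m" "x \<in> carrier_vec m"
  shows "shifted_krylov S l x k \<in> carrier_vec m"
  using assms by (induction k) auto

text \<open>Only the subdiagonal of a Hessenberg matrix moves mass into a new coordinate, so the shifts have no
effect on the leading entry.\<close>

lemma hessenberg_shifted_krylov:
  fixes S :: "complex mat"
  assumes S: "S \<in> carrier_mat m m" and k: "k < m"
    and hess: "\<And>i j. i < m \<Longrightarrow> j < m \<Longrightarrow> Suc j < i \<Longrightarrow> S $$ (i, j) = 0"
  shows "\<And>i. i < m \<Longrightarrow> k < i \<Longrightarrow> shifted_krylov S l (unit_vec m 0) k $ i = 0"
    and "shifted_krylov S l (unit_vec m 0) k $ k = (\<Prod>j<k. S $$ (Suc j, j))"
proof -
  define x where "x = shifted_krylov S l (unit_vec m 0)"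
  have car: "x k \<in> carrier_vec m" for k
    unfolding x_def by (intro shifted_krylov_carrier[OF S]) simp
  have "(\<forall>i<m. k < i \<longrightarrow> x k $ i = 0) \<and> x k $ k = (\<Prod>j<k. S $$ (Suc j, j))"
    using k
  proof (induction k)
    case 0
    then show ?case by (auto simp: x_def)
  next
    case (Suc k)
    have nth: "x (Suc k) $ i = (\<Sum>j<m. S $$ (i, j) * x k $ j)" if "i < m" "k < i" for i
    proof -
      have "x (Suc k) $ i = (S *\<^sub>v x k) $ i - l k * x k $ i"
        using car[of k] S that by (simp add: x_def)
      then show ?thesis
        using Suc that by (simp only: mult_mat_vec_nth_sum[OF S car that(1)]) simp
    qed
    have zero: "x (Suc k) $ i = 0" if i: "i < m" "Suc k < i" for i
    proof -
      have "S $$ (i, j) * x k $ j = 0" if "j < m" for j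
        using Suc hess[of i j] that i by (cases "k < j") auto
      then show ?thesis using nth[of i] i by (simp add: sum.neutral del: mult_eq_0_iff)
    qed
    have "(\<Sum>j<m. S $$ (Suc k, j) * x k $ j) = (\<Sum>j\<in>{k}. S $$ (Suc k, j) * x k $ j)"
    proof (rule sum.mono_neutral_right)
      show "\<forall>j\<in>{..<m} - {k}. S $$ (Suc k, j) * x k $ j = 0"
      proof
        fix j assume "j \<in> {..<m} - {k}"
        then show "S $$ (Suc k, j) * x k $ j = 0"
          using Suc hess[of "Suc k" j] by (cases "k < j") auto
      qed
    qed (use Suc.prems in auto)
    then show ?case using zero nth[of "Suc k"] Suc by simp
  qed
  then show "\<And>i. i < m \<Longrightarrow> k < i \<Longrightarrow> shifted_krylov S l (unit_vec m 0) k $ i = 0"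
    and "shifted_krylov S l (unit_vec m 0) k $ k = (\<Prod>j<k. S $$ (Suc j, j))"
    by (auto simp: x_def)
qed

text \<open>Cayley--Hamilton in factored form, read off from an upper triangular form: with the diagonal entries
taken as shifts from the bottom to the top, each factor makes one more trailing coordinate vanish.\<close>

lemma eigenvalue_shifts_annihilate:
  fixes S :: "complex mat"
  assumes S: "S \<in> carrier_mat m m"
  obtains l where "\<And>k. k < m \<Longrightarrow> eigenvalue S (l k)"
    and "\<And>x. x \<in> carrier_vec m \<Longrightarrow> shifted_krylov S l x m = 0\<^sub>v m"
proof -
  obtain es where es: "char_poly S = (\<Prod>e\<leftarrow>es. [:- e, 1:])"
    using char_poly_factorized[OF S] by blast
  obtain R P Q where "schur_decomposition S es = (R, P, Q)" by (cases "schur_decomposition S es")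
  from schur_decomposition[OF S es this]
  have sim: "similar_mat_wit S R P Q" and tri: "upper_triangular R" and diag: "diag_mat R = es" by auto
  note w = similar_mat_witD2[OF S sim]
  define l where "l = (\<lambda>k. R $$ (m - Suc k, m - Suc k))"
  have "eigenvalue S (l k)" if "k < m" for k
  proof -
    have "l k \<in> set es" using that w(5) unfolding diag[symmetric] l_def diag_mat_def by auto
    then show ?thesis unfolding eigenvalue_root_char_poly[OF S] es by (auto simp: poly_prod_list prod_list_zero_iff)
  qed
  moreover have "shifted_krylov S l x m = 0\<^sub>v m" if x: "x \<in> carrier_vec m" for x
  proof -
    define y where "y = shifted_krylov S l x"
    have y: "y k \<in> carrier_vec m" for k
      unfolding y_def by (rule shifted_krylov_carrier[OF S x])
    have y_Suc: "y (Suc k) = S *\<^sub>v y k - l k \<cdot>\<^sub>v y k" for k by (simp add: y_def)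
    have Qy: "Q *\<^sub>v y k \<in> carrier_vec m" for k using w(7) y by (rule mult_mat_vec_carrier)
    have QS: "Q * S = R * Q"
    proof -
      have "Q * S = Q * (P * (R * Q))" unfolding w(3) using w by (simp add: assoc_mult_mat[of _ m m _ m _ m])
      also have "\<dots> = (Q * P) * (R * Q)"
        by (rule assoc_mult_mat[OF w(7,6), symmetric]) (rule mult_carrier_mat[OF w(5,7)])
      also have "\<dots> = R * Q" using w by simp
      finally show ?thesis .
    qed
    have step: "Q *\<^sub>v y (Suc k) = R *\<^sub>v (Q *\<^sub>v y k) - l k \<cdot>\<^sub>v (Q *\<^sub>v y k)" for k
    proof -
      have "Q *\<^sub>v y (Suc k) = Q *\<^sub>v (S *\<^sub>v y k) - Q *\<^sub>v (l k \<cdot>\<^sub>v y k)"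
        unfolding y_Suc using S y by (intro mult_minus_distrib_mat_vec[OF w(7)]) auto
      also have "Q *\<^sub>v (l k \<cdot>\<^sub>v y k) = l k \<cdot>\<^sub>v (Q *\<^sub>v y k)"
        by (rule mult_mat_vec[OF w(7) y])
      also have "Q *\<^sub>v (S *\<^sub>v y k) = Q * S *\<^sub>v y k"
        by (rule assoc_mult_mat_vec[OF w(7) S y, symmetric])
      also have "\<dots> = R *\<^sub>v (Q *\<^sub>v y k)"
        unfolding QS by (rule assoc_mult_mat_vec[OF w(5,7) y])
      finally show ?thesis .
    qed
    have "k \<le> m \<Longrightarrow> i < m \<Longrightarrow> m - k \<le> i \<Longrightarrow> (Q *\<^sub>v y k) $ i = 0" for k i
    proof (induction k arbitrary: i)
      case 0
      then show ?case by simp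
    next
      case (Suc k)
      define z where "z = Q *\<^sub>v y k"
      have z: "z \<in> carrier_vec m" unfolding z_def by (rule Qy)
      have z0: "z $ j = 0" if "j < m" "m - k \<le> j" for j
        unfolding z_def using Suc.IH[of j] Suc.prems that by simp
      have "(R *\<^sub>v z) $ i = (\<Sum>j<m. R $$ (i, j) * z $ j)"
        by (rule mult_mat_vec_nth_sum[OF w(5) z Suc.prems(2)])
      also have "\<dots> = (\<Sum>j\<in>{i}. R $$ (i, j) * z $ j)"
      proof (rule sum.mono_neutral_right)
        show "\<forall>j\<in>{..<m} - {i}. R $$ (i, j) * z $ j = 0"
        proof
          fix j assume j: "j \<in> {..<m} - {i}"
          show "R $$ (i, j) * z $ j = 0"
          proof (cases "j < i")
            case True
            then have "R $$ (i, j) = 0" using upper_triangularD[OF tri, of j i] Suc.prems w(5) by simp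
            then show ?thesis by simp
          next
            case False
            then have "z $ j = 0" using j Suc.prems by (intro z0) auto
            then show ?thesis by simp
          qed
        qed
      qed (use Suc.prems in auto)
      finally have Rz: "(R *\<^sub>v z) $ i = R $$ (i, i) * z $ i" by simp
      have "(Q *\<^sub>v y (Suc k)) $ i = (R *\<^sub>v z) $ i - l k * z $ i"
        unfolding step z_def[symmetric] using z w(5) Suc.prems by simp
      also have "\<dots> = (R $$ (i, i) - l k) * z $ i" unfolding Rz by (simp add: left_diff_distrib)
      also have "\<dots> = 0"
      proof (cases "m - k \<le> i")
        case True
        then show ?thesis using z0 Suc.prems by simp
      next
        case False
        then have "i = m - Suc k" using Suc.prems by simp
        then show ?thesis by (simp add: l_def)
      qed
      finally show ?case .
    qed
    from this[of m] have "Q *\<^sub>v y m = 0\<^sub>v m"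
      using w(7) by (intro eq_vecI) auto
    then have "P *\<^sub>v (Q *\<^sub>v y m) = P *\<^sub>v 0\<^sub>v m" by simp
    also have "\<dots> = 0\<^sub>v m" using w(6) by (intro eq_vecI) auto
    finally have "P *\<^sub>v (Q *\<^sub>v y m) = 0\<^sub>v m" .
    moreover have "P *\<^sub>v (Q *\<^sub>v y m) = y m"
      unfolding assoc_mult_mat_vec[OF w(6,7) y, symmetric] w(1) using y by simp
    ultimately show ?thesis by (simp add: y_def)
  qed
  ultimately show thesis by (rule that)
qed

text \<open>Classically, the corner entry of the exponential is the product of the subdiagonal entries times a
divided difference of $z \mapsto e^{tz}$ at the eigenvalues, which the Hermite--Genocchi formula
bounds. The divided difference can be avoided. With $x_k$ the shifted Krylov vectors of $e_1$ for the
eigenvalues $l_k$ and $f_k(t)$ the last entry of $e^{tS}x_k$, the functions satisfy the scalar cascade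
$f_k' = l_k f_k + f_{k+1}$ with $f_m = 0$, with $f_k(0) = 0$ for $k < m - 1$ and with $f_{m-1}(0)$
the product of the subdiagonal entries. As $\mathrm{Re}\,l_k \le 0$, going down from $k + 1$ to $k$
costs one integration of the bound, which yields $t^{m-1}/(m-1)!$ at $k = 0$.\<close>

lemma hessenberg_exp_last_entry_le:
  fixes S :: "complex mat"
  assumes S: "S \<in> carrier_mat m m" and m: "0 < m" and diss: "dissipative S"
    and hess: "\<And>i j. i < m \<Longrightarrow> j < m \<Longrightarrow> Suc j < i \<Longrightarrow> S $$ (i, j) = 0"
    and t: "0 \<le> t"
  shows "cmod (exp_flow S (unit_vec m 0) t $ (m - 1))
      \<le> cmod (\<Prod>j<m - 1. S $$ (Suc j, j)) * t ^ (m - 1) / fact (m - 1)"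
proof -
  obtain l where ev: "\<And>k. k < m \<Longrightarrow> eigenvalue S (l k)"
    and ann: "\<And>x. x \<in> carrier_vec m \<Longrightarrow> shifted_krylov S l x m = 0\<^sub>v m"
    using eigenvalue_shifts_annihilate[OF S] by blast
  define x where "x = shifted_krylov S l (unit_vec m 0)"
  define f where "f = (\<lambda>k t. exp_flow S (x k) t $ (m - 1))"
  define g where "g = cmod (\<Prod>j<m - 1. S $$ (Suc j, j))"
  have car: "x k \<in> carrier_vec m" for k
    unfolding x_def by (intro shifted_krylov_carrier[OF S]) simp
  have f_der: "(f k has_vector_derivative f (Suc k) t + l k * f k t) (at t)" for k t
  proof -
    have "S *\<^sub>v x k = x (Suc k) + l k \<cdot>\<^sub>v x k"
      using S car[of k] by (intro eq_vecI) (auto simp: x_def)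
    then have "exp_flow S (S *\<^sub>v x k) t $ (m - 1) = f (Suc k) t + l k * f k t"
      using m exp_flow_carrier[OF S, of "x k" t] car[of k] car[of "Suc k"]
      by (simp add: f_def exp_flow_add[OF S] exp_flow_smult[OF S])
    then show ?thesis
      using exp_flow_has_vector_derivative[OF S car[of k], of "m - 1" t] m by (simp add: f_def)
  qed
  have grow: "cmod (f k t) \<le> cmod (f k 0) + c * t ^ Suc j / fact (Suc j)"
    if k: "k < m" and f: "\<And>t. 0 \<le> t \<Longrightarrow> cmod (f (Suc k) t) \<le> c * t ^ j / fact j" and t: "0 \<le> t"
    for k c j t
  proof -
    have "Re (l k * f k t * cnj (f k t)) \<le> 0" for t
    proof -
      have "l k * f k t * cnj (f k t) = l k * complex_of_real ((cmod (f k t))\<^sup>2)"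
        by (simp only: complex_norm_square mult.assoc)
      moreover have "Re (l k * complex_of_real r) = Re (l k) * r" for r by simp
      ultimately have "Re (l k * f k t * cnj (f k t)) = Re (l k) * (cmod (f k t))\<^sup>2" by (simp only:)
      then show ?thesis
        using dissipative_eigenvalue[OF S diss ev[OF k]] by (simp add: mult_nonpos_nonneg)
    qed
    then show ?thesis
      using L2_growth_le[of "{()}" "\<lambda>_. f k" "\<lambda>_ t. f (Suc k) t + l k * f k t" "\<lambda>_. f (Suc k)" c j t]
        f_der f t by simp
  qed
  have f0: "f k 0 = x k $ (m - 1)" for k
    using exp_flow_0[OF S car] by (simp add: f_def)
  have "cmod (f (m - 1 - j) t) \<le> g * t ^ j / fact j" if "j < m" "0 \<le> t" for j t
    using that
  proof (induction j arbitrary: t)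
    case 0
    have "x (Suc (m - 1)) = 0\<^sub>v m" using ann m by (simp add: x_def)
    then have "f (Suc (m - 1)) t = 0" for t
      using m exp_flow_zero[OF S] by (simp add: f_def)
    then have "cmod (f (m - 1) t) \<le> cmod (f (m - 1) 0) + 0 * t ^ Suc 0 / fact (Suc 0)"
      using 0 by (intro grow) auto
    also have "cmod (f (m - 1) 0) = g"
      unfolding f0 g_def x_def using hessenberg_shifted_krylov(2)[OF S _ hess, of "m - 1"] m by simp
    finally show ?case by simp
  next
    case (Suc j)
    have k: "Suc (m - 1 - Suc j) = m - 1 - j" using Suc.prems by simp
    have ih: "cmod (f (Suc (m - 1 - Suc j)) t) \<le> g * t ^ j / fact j" if "0 \<le> t" for t
      unfolding k using Suc.prems that by (intro Suc.IH) simp_all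
    have "cmod (f (m - 1 - Suc j) t) \<le> cmod (f (m - 1 - Suc j) 0) + g * t ^ Suc j / fact (Suc j)"
      using Suc.prems by (intro grow ih) simp_all
    also have "f (m - 1 - Suc j) 0 = 0"
      unfolding f0 x_def using hessenberg_shifted_krylov(1)[OF S _ hess, of "m - 1 - Suc j" "m - 1"] Suc.prems by simp
    finally show ?case by simp
  qed
  from this[of "m - 1" t] show ?thesis using m t by (simp add: f_def g_def x_def)
qed

section \<open>The error of the Krylov approximation\<close>

text \<open>The rotation by $\sigma$ is absorbed into the matrices: $M = \sigma A$, $S = \sigma T_m$ and
$\beta = \sigma\tau_{m+1,m}$. What drives the error analysis is the
recurrence together with the Hessenberg shape of $S$.\<close>

locale arnoldi_relation =
  fixes n m :: nat and M V S :: "complex mat" and w :: "complex vec" and \<beta> :: complex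
  assumes M: "M \<in> carrier_mat n n" and V: "V \<in> carrier_mat n m" and S: "S \<in> carrier_mat m m"
    and w: "w \<in> carrier_vec n" and norm_w: "vec_norm2 w = 1" and m: "0 < m"
    and hess: "\<And>i j. i < m \<Longrightarrow> j < m \<Longrightarrow> Suc j < i \<Longrightarrow> S $$ (i, j) = 0"
    and rel: "M * V = V * S + \<beta> \<cdot>\<^sub>m outer_prod w (unit_vec m (m - 1))"
begin

definition start :: "complex vec" where "start = V *\<^sub>v unit_vec m 0"
definition subdiag_prod :: complex where "subdiag_prod = (\<Prod>j<m - 1. S $$ (Suc j, j))"
definition error :: "real \<Rightarrow> complex vec" where
  "error t = exp_flow M start t - V *\<^sub>v exp_flow S (unit_vec m 0) t"

lemma start_carrier: "start \<in> carrier_vec n"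
  using V unfolding start_def by simp

lemma error_carrier: "error t \<in> carrier_vec n"
  using V exp_flow_carrier[OF M] exp_flow_carrier[OF S] unfolding error_def by auto

lemma mult_basis_vec:
  assumes y: "y \<in> carrier_vec m"
  shows "M *\<^sub>v (V *\<^sub>v y) = V *\<^sub>v (S *\<^sub>v y) + (\<beta> * y $ (m - 1)) \<cdot>\<^sub>v w"
proof -
  let ?E = "\<beta> \<cdot>\<^sub>m outer_prod w (unit_vec m (m - 1))"
  have E: "?E \<in> carrier_mat n m" using w by (simp add: outer_prod_def)
  have "?E *\<^sub>v y = (\<beta> * y $ (m - 1)) \<cdot>\<^sub>v w"
  proof (rule eq_vecI)
    fix i assume "i < dim_vec ((\<beta> * y $ (m - 1)) \<cdot>\<^sub>v w)"
    then have i: "i < n" using w by simp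
    have "(?E *\<^sub>v y) $ i = (\<Sum>j<m. if j = m - 1 then \<beta> * w $ i * y $ j else 0)"
      unfolding mult_mat_vec_nth_sum[OF E y i] using i w
      by (intro sum.cong) (auto simp: outer_prod_def)
    also have "\<dots> = ((\<beta> * y $ (m - 1)) \<cdot>\<^sub>v w) $ i" using m i w by simp
    finally show "(?E *\<^sub>v y) $ i = ((\<beta> * y $ (m - 1)) \<cdot>\<^sub>v w) $ i" .
  qed (use w in \<open>simp add: outer_prod_def\<close>)
  moreover have "M *\<^sub>v (V *\<^sub>v y) = V * S *\<^sub>v y + ?E *\<^sub>v y"
    unfolding assoc_mult_mat_vec[OF M V y, symmetric] rel
    using V S E y by (intro add_mult_distrib_mat_vec[of _ n m]) auto
  ultimately show ?thesis unfolding assoc_mult_mat_vec[OF V S y] by simp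
qed

text \<open>The approximation solves the differential equation up to a defect in the direction of $w$, whose size
is governed by the last entry of $e^{tS}e_1$.\<close>

lemma error_has_vector_derivative:
  assumes i: "i < n"
  shows "((\<lambda>t. error t $ i) has_vector_derivative
    (M *\<^sub>v error t) $ i + \<beta> * exp_flow S (unit_vec m 0) t $ (m - 1) * w $ i) (at t)"
proof -
  let ?e = "unit_vec m 0 :: complex vec"
  let ?y = "exp_flow S ?e t"
  have y: "exp_flow S x t \<in> carrier_vec m" for x t by (rule exp_flow_carrier[OF S])
  have u: "exp_flow M x t \<in> carrier_vec n" for x t by (rule exp_flow_carrier[OF M])
  have error_nth: "error t $ i = exp_flow M start t $ i - (\<Sum>j<m. V $$ (i, j) * exp_flow S ?e t $ j)" for t
    using i V y[of ?e t] unfolding error_def mult_mat_vec_nth_sum[OF V y i, symmetric] by simp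
  have "M *\<^sub>v error t = M *\<^sub>v exp_flow M start t - M *\<^sub>v (V *\<^sub>v ?y)"
    unfolding error_def using V u y by (intro mult_minus_distrib_mat_vec[OF M]) auto
  then have "(M *\<^sub>v error t) $ i + \<beta> * ?y $ (m - 1) * w $ i
      = exp_flow M (M *\<^sub>v start) t $ i - (V *\<^sub>v exp_flow S (S *\<^sub>v ?e) t) $ i"
    using i M V S w y by (simp add: mult_basis_vec[OF y] exp_flow_mult_vec[OF M start_carrier]
        exp_flow_mult_vec[OF S] del: index_mult_mat_vec)
  then have D: "(M *\<^sub>v error t) $ i + \<beta> * ?y $ (m - 1) * w $ i
      = exp_flow M (M *\<^sub>v start) t $ i - (\<Sum>j<m. V $$ (i, j) * exp_flow S (S *\<^sub>v ?e) t $ j)"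
    unfolding mult_mat_vec_nth_sum[OF V y i] .
  show ?thesis
    unfolding error_nth D
    by (intro has_vector_derivative_diff has_vector_derivative_sum exp_flow_has_vector_derivative[OF M start_carrier i]
        bounded_linear.has_vector_derivative[OF bounded_linear_mult_right] exp_flow_has_vector_derivative[OF S]) auto
qed

text \<open>The defect is at most $|\beta|$ times the corner entry bound, of order $t^{m-1}$; the growth estimate
integrates it once more.\<close>

lemma norm_error_le:
  assumes diss: "dissipative M" "dissipative S" and t: "0 \<le> t"
  shows "vec_norm2 (error t) \<le> cmod \<beta> * cmod subdiag_prod * t ^ m / fact m"
proof -
  let ?y = "\<lambda>t. exp_flow S (unit_vec m 0) t $ (m - 1)"
  have norm_eq: "L2_set (\<lambda>i. cmod (error t $ i)) {..<n} = vec_norm2 (error t)" for t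
    using error_carrier[of t] by (simp add: vec_norm2_eq_L2_set)
  have "error 0 = 0\<^sub>v n"
    using V start_carrier unfolding error_def exp_flow_0[OF M start_carrier] exp_flow_0[OF S unit_vec_carrier]
    by (simp add: start_def)
  then have e0: "vec_norm2 (error 0) = 0" by (simp add: vec_norm2_def)
  have "L2_set (\<lambda>i. cmod (error t $ i)) {..<n} \<le> L2_set (\<lambda>i. cmod (error 0 $ i)) {..<n}
      + cmod \<beta> * cmod subdiag_prod * t ^ Suc (m - 1) / fact (Suc (m - 1))"
  proof (rule L2_growth_le[OF _ _ _ t])
    fix i t assume "i \<in> {..<n}"
    then show "((\<lambda>t. error t $ i) has_vector_derivative (M *\<^sub>v error t) $ i + \<beta> * ?y t * w $ i) (at t)"
      by (intro error_has_vector_derivative) simp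
  next
    fix t :: real
    have "(\<Sum>i<n. ((M *\<^sub>v error t) $ i + \<beta> * ?y t * w $ i - \<beta> * ?y t * w $ i) * cnj (error t $ i))
        = (M *\<^sub>v error t) \<bullet>c error t"
      using error_carrier[of t] by (simp add: cscalar_prod_sum[of _ n] del: index_mult_mat_vec)
    then show "Re (\<Sum>i<n. ((M *\<^sub>v error t) $ i + \<beta> * ?y t * w $ i - \<beta> * ?y t * w $ i) * cnj (error t $ i)) \<le> 0"
      using diss(1) error_carrier[of t] M unfolding dissipative_def by auto
  next
    fix t :: real assume t: "0 \<le> t"
    have "L2_set (\<lambda>i. cmod (\<beta> * ?y t * w $ i)) {..<n} = cmod (\<beta> * ?y t) * vec_norm2 w"
      using w by (simp add: vec_norm2_eq_L2_set L2_set_right_distrib[symmetric] norm_mult)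
    also have "\<dots> \<le> cmod \<beta> * (cmod subdiag_prod * t ^ (m - 1) / fact (m - 1))"
      unfolding norm_mult norm_w subdiag_prod_def mult_1_right
      by (rule mult_left_mono[OF hessenberg_exp_last_entry_le[OF S m diss(2) hess t] norm_ge_zero])
    finally show "L2_set (\<lambda>i. cmod (\<beta> * ?y t * w $ i)) {..<n}
        \<le> cmod \<beta> * cmod subdiag_prod * t ^ (m - 1) / fact (m - 1)" by simp
  qed
  then show ?thesis unfolding norm_eq e0 using m by simp
qed

text \<open>The first $m$ moments are matched because $S^k e_1$ does not reach the last coordinate for
$k < m - 1$; the first mismatch, at $k = m$, is a multiple of $w$.\<close>

lemma pow_start_eq:
  assumes "k < m"
  shows "M ^\<^sub>m k *\<^sub>v start = V *\<^sub>v (S ^\<^sub>m k *\<^sub>v unit_vec m 0)"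
    and "M ^\<^sub>m Suc k *\<^sub>v start = V *\<^sub>v (S ^\<^sub>m Suc k *\<^sub>v unit_vec m 0)
      + (\<beta> * (S ^\<^sub>m k *\<^sub>v unit_vec m 0) $ (m - 1)) \<cdot>\<^sub>v w"
proof -
  let ?e = "unit_vec m 0 :: complex vec"
  have y: "S ^\<^sub>m k *\<^sub>v ?e \<in> carrier_vec m" for k
    using pow_carrier_mat[OF S] by (rule mult_mat_vec_carrier) simp
  have step: "M ^\<^sub>m Suc k *\<^sub>v start = V *\<^sub>v (S ^\<^sub>m Suc k *\<^sub>v ?e) + (\<beta> * (S ^\<^sub>m k *\<^sub>v ?e) $ (m - 1)) \<cdot>\<^sub>v w"
    if "M ^\<^sub>m k *\<^sub>v start = V *\<^sub>v (S ^\<^sub>m k *\<^sub>v ?e)" for k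
    unfolding pow_mat_Suc_mult_vec_left[OF M start_carrier] pow_mat_Suc_mult_vec_left[OF S unit_vec_carrier]
      that mult_basis_vec[OF y] ..
  have eq: "k < m \<Longrightarrow> M ^\<^sub>m k *\<^sub>v start = V *\<^sub>v (S ^\<^sub>m k *\<^sub>v ?e)" for k
  proof (induction k)
    case 0
    show ?case using M V S start_carrier by (simp add: start_def)
  next
    case (Suc k)
    have "(S ^\<^sub>m k *\<^sub>v ?e) $ (m - 1) = (S ^\<^sub>m k) $$ (m - 1, 0)"
      using m pow_carrier_mat[OF S, of k] row_carrier_vec[of "m - 1" m, OF _ pow_carrier_mat[OF S, of k]]
      by (simp add: scalar_prod_right_unit[where n = m] del: pow_mat_dim)
    also have "\<dots> = 0"
      using hessenberg_pow_col(1)[OF S m, of k] hess Suc.prems by simp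
    finally have "(S ^\<^sub>m k *\<^sub>v ?e) $ (m - 1) = 0" .
    moreover have "V *\<^sub>v (S ^\<^sub>m Suc k *\<^sub>v ?e) \<in> carrier_vec n"
      using V y by (rule mult_mat_vec_carrier)
    moreover have "0 \<cdot>\<^sub>v w = 0\<^sub>v n" using w by (intro eq_vecI) auto
    ultimately show ?case
      using step[OF Suc.IH] Suc.prems w by (simp del: pow_mat.simps)
  qed
  show "M ^\<^sub>m k *\<^sub>v start = V *\<^sub>v (S ^\<^sub>m k *\<^sub>v ?e)" using assms by (rule eq)
  then show "M ^\<^sub>m Suc k *\<^sub>v start = V *\<^sub>v (S ^\<^sub>m Suc k *\<^sub>v ?e)
      + (\<beta> * (S ^\<^sub>m k *\<^sub>v ?e) $ (m - 1)) \<cdot>\<^sub>v w"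
    by (rule step)
qed

lemma error_entry_remainder_le:
  assumes i: "i < n"
  obtains C where "\<And>t. 0 \<le> t \<Longrightarrow> t \<le> 1 \<Longrightarrow>
    cmod (error t $ i - \<beta> * subdiag_prod / fact m * complex_of_real t ^ m * w $ i) \<le> C * t ^ Suc m"
proof -
  let ?e = "unit_vec m 0 :: complex vec"
  define a where "a = (\<lambda>k. (M ^\<^sub>m k *\<^sub>v start) $ i / fact k)"
  define b where "b = (\<lambda>k. (V *\<^sub>v (S ^\<^sub>m k *\<^sub>v ?e)) $ i / fact k)"
  have sa: "summable (\<lambda>k. a k * z ^ k)" for z
    unfolding a_def by (rule exp_flow_summable[OF M start_carrier i])
  have sb: "summable (\<lambda>k. b k * z ^ k)" for z
    unfolding b_def by (rule mult_exp_flow_summable[OF S unit_vec_carrier V i])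
  have series: "error t $ i = (\<Sum>k. (a k - b k) * complex_of_real t ^ k)" for t
  proof -
    have "error t $ i = exp_flow M start t $ i - (V *\<^sub>v exp_flow S ?e t) $ i"
      using i V unfolding error_def by simp
    also have "\<dots> = (\<Sum>k. a k * complex_of_real t ^ k) - (\<Sum>k. b k * complex_of_real t ^ k)"
      unfolding exp_flow_nth[OF M start_carrier i] mult_exp_flow_nth[OF S unit_vec_carrier V i] a_def b_def ..
    also have "\<dots> = (\<Sum>k. (a k - b k) * complex_of_real t ^ k)"
      unfolding suminf_diff[OF sa sb] by (simp add: left_diff_distrib)
    finally show ?thesis .
  qed
  have zero: "a k - b k = 0" if "k < m" for k
    unfolding a_def b_def pow_start_eq(1)[OF that] by simp
  have "a m - b m = \<beta> * subdiag_prod / fact m * w $ i"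
  proof -
    have "(S ^\<^sub>m (m - 1) *\<^sub>v ?e) $ (m - 1) = (S ^\<^sub>m (m - 1)) $$ (m - 1, 0)"
      using m pow_carrier_mat[OF S, of "m - 1"] row_carrier_vec[of "m - 1" m, OF _ pow_carrier_mat[OF S, of "m - 1"]]
      by (simp add: scalar_prod_right_unit[where n = m] del: pow_mat_dim)
    also have "\<dots> = subdiag_prod"
      using hessenberg_pow_col(2)[OF S m, of "m - 1"] hess m by (simp add: subdiag_prod_def)
    finally have "M ^\<^sub>m m *\<^sub>v start = V *\<^sub>v (S ^\<^sub>m m *\<^sub>v ?e) + (\<beta> * subdiag_prod) \<cdot>\<^sub>v w"
      using pow_start_eq(2)[of "m - 1"] m by (simp del: pow_mat.simps)
    then have "(M ^\<^sub>m m *\<^sub>v start) $ i = (V *\<^sub>v (S ^\<^sub>m m *\<^sub>v ?e)) $ i + \<beta> * subdiag_prod * w $ i"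
      using i w V by (simp del: index_mult_mat_vec)
    then show ?thesis by (simp add: a_def b_def diff_divide_distrib[symmetric] del: index_mult_mat_vec)
  qed
  then have partial: "(\<Sum>k<Suc m. (a k - b k) * complex_of_real t ^ k)
      = \<beta> * subdiag_prod / fact m * complex_of_real t ^ m * w $ i" for t
    using zero by simp
  have "summable (\<lambda>k. (a k - b k) * z ^ k)" for z
    using summable_diff[OF sa sb] by (simp add: left_diff_distrib)
  from powser_remainder_le[OF this, of "Suc m"] show thesis
    unfolding series[symmetric] partial using that by blast
qed

text \<open>By moment matching the power series of the error starts with $\beta\,\pi\,w\,t^m/m!$, where $\pi$ is
the product of the subdiagonal entries, and $w$ is a unit vector.\<close>

lemma norm_error_asymptotic:
  obtains C where "\<And>t. 0 \<le> t \<Longrightarrow> t \<le> 1 \<Longrightarrow>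
    \<bar>vec_norm2 (error t) - cmod \<beta> * cmod subdiag_prod * t ^ m / fact m\<bar> \<le> C * t ^ Suc m"
proof -
  define lead where "lead = (\<lambda>t. (\<beta> * subdiag_prod / fact m * complex_of_real t ^ m) \<cdot>\<^sub>v w)"
  have lead: "lead t \<in> carrier_vec n" for t using w by (simp add: lead_def)
  have "\<forall>i\<in>{..<n}. \<exists>C. \<forall>t. 0 \<le> t \<longrightarrow> t \<le> 1 \<longrightarrow> cmod (error t $ i - lead t $ i) \<le> C * t ^ Suc m"
  proof
    fix i assume "i \<in> {..<n}"
    then have i: "i < n" by simp
    obtain C where
      "\<And>t. 0 \<le> t \<Longrightarrow> t \<le> 1 \<Longrightarrow>
        cmod (error t $ i - \<beta> * subdiag_prod / fact m * complex_of_real t ^ m * w $ i) \<le> C * t ^ Suc m"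
      using error_entry_remainder_le[OF i] by blast
    then show "\<exists>C. \<forall>t. 0 \<le> t \<longrightarrow> t \<le> 1 \<longrightarrow> cmod (error t $ i - lead t $ i) \<le> C * t ^ Suc m"
      using i w by (intro exI[of _ C]) (simp add: lead_def)
  qed
  from bchoice[OF this] obtain C where
    C: "\<And>i t. i < n \<Longrightarrow> 0 \<le> t \<Longrightarrow> t \<le> 1 \<Longrightarrow> cmod (error t $ i - lead t $ i) \<le> C i * t ^ Suc m"
    by auto
  have "\<bar>vec_norm2 (error t) - cmod \<beta> * cmod subdiag_prod * t ^ m / fact m\<bar> \<le> (\<Sum>i<n. C i) * t ^ Suc m"
    if t: "0 \<le> t" "t \<le> 1" for t
  proof -
    let ?r = "error t - lead t"
    have r: "?r \<in> carrier_vec n" using error_carrier lead by simp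
    have "vec_norm2 ?r \<le> (\<Sum>i<n. cmod (?r $ i))"
      unfolding vec_norm2_eq_L2_set carrier_vecD[OF r] by (rule L2_set_le_sum) simp
    also have "\<dots> \<le> (\<Sum>i<n. C i * t ^ Suc m)"
      using C t lead[of t] error_carrier[of t] by (intro sum_mono) simp
    finally have r_le: "vec_norm2 ?r \<le> (\<Sum>i<n. C i) * t ^ Suc m" by (simp only: sum_distrib_right)
    have "error t = lead t + ?r" "lead t = error t + (- 1) \<cdot>\<^sub>v ?r"
      using error_carrier[of t] lead[of t] by (auto intro!: eq_vecI)
    then have "vec_norm2 (error t) \<le> vec_norm2 (lead t) + vec_norm2 ?r"
      "vec_norm2 (lead t) \<le> vec_norm2 (error t) + vec_norm2 ?r"
      using vec_norm2_triangle[of "lead t" ?r] vec_norm2_triangle[of "error t" "(- 1) \<cdot>\<^sub>v ?r"]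
        error_carrier[of t] lead[of t] vec_norm2_smult[of "- 1" ?r] by simp_all
    moreover have "vec_norm2 (lead t) = cmod \<beta> * cmod subdiag_prod * t ^ m / fact m"
      using t norm_w by (simp add: lead_def vec_norm2_smult norm_mult norm_divide norm_power)
    ultimately show ?thesis using r_le by linarith
  qed
  then show thesis by (rule that)
qed

end

section \<open>The error bound and its asymptotic correctness\<close>

theorem proposition3:
  fixes A V T :: "complex mat" and v w :: "complex vec"
    and \<sigma> :: complex and \<tau> :: real and n m :: nat
  assumes "A \<in> carrier_mat n n"
    and "v \<in> carrier_vec n"
    and "vec_norm2 v = 1"
    and "cmod \<sigma> = 1"
    and "1 \<le> m"
    and "no_breakdown A v m"
    and "krylov_decomposition A v m V T \<tau> w"
    and "log_norm2 (\<sigma> \<cdot>\<^sub>m A) \<le> 0"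
  shows "(\<forall>t\<ge>0. vec_norm2 (krylov_error \<sigma> A v V T t) \<le> \<tau> * krylov_gamma T * t ^ m / fact m) \<and>
    (\<lambda>t. vec_norm2 (krylov_error \<sigma> A v V T t) - \<tau> * krylov_gamma T * t ^ m / fact m)
      \<in> O[at_right 0](\<lambda>t. t ^ (m + 1))"
proof -
  note A = assms(1) and v = assms(2) and K = assms(7)
  define M where "M = \<sigma> \<cdot>\<^sub>m A"
  define S where "S = \<sigma> \<cdot>\<^sub>m T"
  have V: "V \<in> carrier_mat n m" and T: "T \<in> carrier_mat m m" and w: "w \<in> carrier_vec n"
    and start: "V *\<^sub>v unit_vec m 0 = v" and T_eq: "T = mat_adjoint V * A * V"
    and hess: "\<forall>i<m. \<forall>j<m. Suc j < i \<longrightarrow> T $$ (i, j) = 0"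
    and \<tau>: "0 < \<tau>" and norm_w: "vec_norm2 w = 1"
    and rel: "A * V = V * T + complex_of_real \<tau> \<cdot>\<^sub>m outer_prod w (unit_vec m (m - 1))"
    using K v unfolding krylov_decomposition_def by auto
  have M: "M \<in> carrier_mat n n" and S: "S \<in> carrier_mat m m" using A T by (auto simp: M_def S_def)
  have adj: "mat_adjoint V \<in> carrier_mat m n" using V by (auto simp: mat_adjoint_def)
  have E: "outer_prod w (unit_vec m (m - 1)) \<in> carrier_mat n m" using w by (simp add: outer_prod_def)
  interpret arnoldi_relation n m M V S w "\<sigma> * complex_of_real \<tau>"
  proof
    show "0 < m" using assms(5) by simp
    show "S $$ (i, j) = 0" if "i < m" "j < m" "Suc j < i" for i j
      using hess that T by (simp add: S_def)
    have "M * V = \<sigma> \<cdot>\<^sub>m (A * V)" unfolding M_def using A V by (rule mult_smult_assoc_mat)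
    also have "\<dots> = \<sigma> \<cdot>\<^sub>m (V * T) + \<sigma> \<cdot>\<^sub>m (complex_of_real \<tau> \<cdot>\<^sub>m outer_prod w (unit_vec m (m - 1)))"
      unfolding rel using V T E by (intro add_smult_distrib_left_mat[of _ n m]) auto
    also have "\<sigma> \<cdot>\<^sub>m (V * T) = V * S"
      unfolding S_def using V T by (rule mult_smult_distrib[symmetric])
    also have "\<sigma> \<cdot>\<^sub>m (complex_of_real \<tau> \<cdot>\<^sub>m outer_prod w (unit_vec m (m - 1)))
        = (\<sigma> * complex_of_real \<tau>) \<cdot>\<^sub>m outer_prod w (unit_vec m (m - 1))"
      by (intro eq_matI) auto
    finally show "M * V = V * S + (\<sigma> * complex_of_real \<tau>) \<cdot>\<^sub>m outer_prod w (unit_vec m (m - 1))" .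
  qed (fact M V S w norm_w)+
  have diss_M: "dissipative M"
    unfolding dissipative_def
  proof
    fix x :: "complex vec" assume "x \<in> carrier_vec (dim_row M)"
    then have "Re ((M *\<^sub>v x) \<bullet>c x) \<le> log_norm2 M * (vec_norm2 x)\<^sup>2"
      using M by (intro Re_cscalar_prod_le_log_norm2) auto
    also have "\<dots> \<le> 0" using assms(8) by (simp add: M_def mult_nonpos_nonneg)
    finally show "Re ((M *\<^sub>v x) \<bullet>c x) \<le> 0" .
  qed
  have "S = mat_adjoint V * M * V"
    unfolding S_def M_def T_eq mult_smult_distrib[OF adj A]
    by (rule mult_smult_assoc_mat[OF mult_carrier_mat[OF adj A] V, symmetric])
  then have diss_S: "dissipative S" using dissipative_compression[OF M V diss_M] by simp
  have smult: "(\<sigma> * complex_of_real t) \<cdot>\<^sub>m B = complex_of_real t \<cdot>\<^sub>m (\<sigma> \<cdot>\<^sub>m B)" for t and B :: "complex mat"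
    by (intro eq_matI) auto
  have err: "krylov_error \<sigma> A v V T t = error t" for t
    using T unfolding krylov_error_def error_def exp_flow_def start_def start smult M_def[symmetric] S_def[symmetric]
    by simp
  have "cmod subdiag_prod = (\<Prod>j<m - 1. cmod (T $$ (Suc j, j)))"
    unfolding subdiag_prod_def prod_norm[symmetric] using T assms(4)
    by (intro prod.cong) (auto simp: S_def norm_mult)
  also have "\<dots> = krylov_gamma T"
    unfolding prod_norm krylov_gamma_eq(2)[OF K assms(5), symmetric]
    using krylov_gamma_eq(3)[OF K assms(5)] by simp
  finally have factor: "cmod (\<sigma> * complex_of_real \<tau>) * cmod subdiag_prod = \<tau> * krylov_gamma T"
    using \<tau> assms(4) by (simp add: norm_mult)
  show ?thesis
  proof (intro conjI allI impI)
    fix t :: real assume "0 \<le> t"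
    then show "vec_norm2 (krylov_error \<sigma> A v V T t) \<le> \<tau> * krylov_gamma T * t ^ m / fact m"
      using norm_error_le[OF diss_M diss_S] unfolding err factor by simp
  next
    obtain C where C: "\<And>t. 0 \<le> t \<Longrightarrow> t \<le> 1 \<Longrightarrow>
        \<bar>vec_norm2 (error t) - \<tau> * krylov_gamma T * t ^ m / fact m\<bar> \<le> C * t ^ Suc m"
      using norm_error_asymptotic unfolding factor by blast
    show "(\<lambda>t. vec_norm2 (krylov_error \<sigma> A v V T t) - \<tau> * krylov_gamma T * t ^ m / fact m)
        \<in> O[at_right 0](\<lambda>t. t ^ (m + 1))"
    proof (rule bigoI)
      have ev: "\<forall>\<^sub>F t in at_right 0. t \<in> {0<..<1::real}"
        by (rule eventually_at_right_real) simp
      show "\<forall>\<^sub>F t in at_right 0. norm (vec_norm2 (krylov_error \<sigma> A v V T t)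
          - \<tau> * krylov_gamma T * t ^ m / fact m) \<le> C * norm (t ^ (m + 1))"
        using ev
      proof eventually_elim
        case (elim t)
        then show ?case using C[of t] by (simp add: err)
      qed
    qed
  qed
qed

end
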